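(* Let $n\ge2$, let $\Omega\subset\mathbb{R}^n$ be a bounded convex domain, and let $v_0,v_1\in C(\overline\Omega)$ be nonzero convex functions that vanish on $\partial\Omega$. For $0\le t\le 1$ let \[ v_t:=\bigl((1-t)v_0^*+t\,v_1^*\bigr)^* \] be the Legendre path connecting $v_0$ and $v_1$. Let $q>1$ be a real number and let $m\ge q$ be an integer, and set \[ S(t):=\int_\Omega |v_t|^q\,dx,\qquad P(t):=S(t)^{1/(n+m)},\qquad t\in[0,1]. \] Then $P$ is concave on $[0,1]$. If $P$ is constant on $[0,1]$, then $v_0=v_1$.
   Context: A convex domain is a nonempty open convex set. "Nonzero" means not identically zero. For a convex $v\in C(\overline\Omega)$, extended by $+\infty$ outside $\overline\Omega$, the Legendre transform is $v^*(y):=\sup\{x\cdot y-v(x):x\in\overline\Omega\}$ for $y\in\mathbb{R}^n$; it is a finite convex function on $\mathbb{R}^n$. For a finite convex function $\phi$ on $\mathbb{R}^n$, $\phi^*(x):=\sup_{y\in\mathbb{R}^n}(x\cdot y-\phi(y))$. The functions $v_t=\phi_t^*$, with $\phi_t=(1-t)v_0^*+t v_1^*$, are regarded as functions on $\overline\Omega$, where they are finite; for $t=0,1$ they coincide with $v_0,v_1$. *)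

theory Defs
  imports "HOL-Analysis.Analysis"
begin

(* Legendre transform of a function that takes the value f on D and +infinity off D.
   The supremum is a real one, so the value is meaningful only where it is finite;
   the two lemmas at the end cover all uses below. *)
definition legendre_on :: "(real ^ 'n) set \<Rightarrow> (real ^ 'n \<Rightarrow> real) \<Rightarrow> real ^ 'n \<Rightarrow> real" where
  "legendre_on D f y = (SUP x\<in>D. x \<bullet> y - f x)"

definition legendre_sum ::
  "(real ^ 'n) set \<Rightarrow> (real ^ 'n \<Rightarrow> real) \<Rightarrow> (real ^ 'n \<Rightarrow> real) \<Rightarrow> real \<Rightarrow> real ^ 'n \<Rightarrow> real" where
  "legendre_sum \<Omega> v0 v1 t y =
     (1 - t) * legendre_on (closure \<Omega>) v0 y + t * legendre_on (closure \<Omega>) v1 y"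

(* To be evaluated at points of the closure of \<Omega> only. *)
definition legendre_path ::
  "(real ^ 'n) set \<Rightarrow> (real ^ 'n \<Rightarrow> real) \<Rightarrow> (real ^ 'n \<Rightarrow> real) \<Rightarrow> real \<Rightarrow> real ^ 'n \<Rightarrow> real" where
  "legendre_path \<Omega> v0 v1 t = legendre_on UNIV (legendre_sum \<Omega> v0 v1 t)"

definition path_S ::
  "(real ^ 'n) set \<Rightarrow> (real ^ 'n \<Rightarrow> real) \<Rightarrow> (real ^ 'n \<Rightarrow> real) \<Rightarrow> real \<Rightarrow> real \<Rightarrow> real" where
  "path_S \<Omega> v0 v1 q t = (LINT x:\<Omega>|lebesgue. \<bar>legendre_path \<Omega> v0 v1 t x\<bar> powr q)"

definition path_P ::
  "(real ^ 'n) set \<Rightarrow> (real ^ 'n \<Rightarrow> real) \<Rightarrow> (real ^ 'n \<Rightarrow> real) \<Rightarrow> real \<Rightarrow> nat \<Rightarrow> real \<Rightarrow> real" where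
  "path_P \<Omega> v0 v1 q m t = path_S \<Omega> v0 v1 q t powr (1 / real (CARD('n) + m))"

lemma legendre_on_closure_bdd:
  fixes \<Omega> :: "(real ^ 'n) set"
  assumes "bounded \<Omega>" "continuous_on (closure \<Omega>) v"
  shows "bdd_above ((\<lambda>x. x \<bullet> y - v x) ` closure \<Omega>)"
proof -
  have "compact (closure \<Omega>)"
    using assms(1) by (simp add: compact_closure)
  moreover have "continuous_on (closure \<Omega>) (\<lambda>x. x \<bullet> y - v x)"
    by (intro continuous_intros assms(2))
  ultimately show ?thesis
    by (intro bounded_imp_bdd_above compact_imp_bounded compact_continuous_image)
qed

lemma legendre_path_bdd:
  fixes \<Omega> :: "(real ^ 'n) set"
  assumes "bounded \<Omega>" "continuous_on (closure \<Omega>) v0" "continuous_on (closure \<Omega>) v1"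
    and t: "t \<in> {0..1}" and x: "x \<in> closure \<Omega>"
  shows "bdd_above (range (\<lambda>y. y \<bullet> x - legendre_sum \<Omega> v0 v1 t y))"
proof (rule bdd_aboveI2)
  fix y
  have "x \<bullet> y - v0 x \<le> legendre_on (closure \<Omega>) v0 y"
    unfolding legendre_on_def by (rule cSUP_upper[OF x legendre_on_closure_bdd[OF assms(1,2)]])
  moreover have "x \<bullet> y - v1 x \<le> legendre_on (closure \<Omega>) v1 y"
    unfolding legendre_on_def by (rule cSUP_upper[OF x legendre_on_closure_bdd[OF assms(1,3)]])
  ultimately have "(1 - t) * (x \<bullet> y - v0 x) + t * (x \<bullet> y - v1 x) \<le> legendre_sum \<Omega> v0 v1 t y"
    unfolding legendre_sum_def using t by (intro add_mono mult_left_mono) auto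
  then show "y \<bullet> x - legendre_sum \<Omega> v0 v1 t y \<le> (1 - t) * v0 x + t * v1 x"
    by (simp add: algebra_simps inner_commute)
qed

end

theory Submission
  imports Defs
begin

text \<open>The functions \<open>u\<^sub>t = - v\<^sub>t\<close> are positive and concave on \<open>\<Omega>\<close> and satisfy
  \<open>(1 - l) u\<^sub>s(x) + l u\<^sub>t(y) \<le> u\<^sub>r((1 - l) x + l y)\<close> for \<open>r = (1 - l) s + l t\<close>. This is the hypothesis of the
  Borell--Brascamp--Lieb inequality for the powers \<open>u\<^sub>t powr q\<close>, so \<open>S powr (1 / (n + q))\<close> is concave, and so
  is its power \<open>P\<close> with exponent \<open>(n + q) / (n + m) \<le> 1\<close>.

  The inequality is proved by integrating out one coordinate at a time. In one variable, monotone
  transport between the two densities reduces it to Jensen's inequality for \<open>x powr (p + 1)\<close>. In the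
  equality case Jensen forces the derivative of the transport map to be 1; as both functions live on
  the same \<open>\<Omega>\<close>, the map is the identity and the two functions agree on every line. Hence equality of the
  total integrals propagates backwards through the coordinates to \<open>u\<^sub>0 = u\<^sub>1\<close>, with no need for the
  equality case of the Brunn--Minkowski inequality. Fenchel--Moreau turns this into \<open>v\<^sub>0 = v\<^sub>1\<close>.\<close>

section \<open>The one-dimensional inequality\<close>

text \<open>Bernoulli's inequality with a real exponent, from \<open>exp z \<ge> 1 + z\<close> at
  \<open>z = p * ln y\<close> followed by \<open>ln y \<ge> 1 - 1 / y\<close>. The second bound is
  sharp only at \<open>y = 1\<close>, which settles the equality case.\<close>

lemma powr_above_tangent:
  fixes y p :: real
  assumes "0 < y" "0 < p"
  shows "1 + (p + 1) * (y - 1) \<le> y powr (p + 1)"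
    and "1 + (p + 1) * (y - 1) = y powr (p + 1) \<Longrightarrow> y = 1"
proof -
  have ln: "1 - 1 / y \<le> ln y" 
    using ln_le_minus_one[of "1 / y"] assms by (simp add: ln_div)
  have "1 + p * ln y \<le> y powr p"
    using exp_ge_add_one_self[of "p * ln y"] assms by (simp add: powr_def)
  then have "y * (1 + p * ln y) \<le> y powr (p + 1)"
    using mult_left_mono[of _ _ y] assms by (simp add: powr_add mult.commute)
  moreover have tan: "y * (1 + p * (1 - 1 / y)) = 1 + (p + 1) * (y - 1)"
    using assms by (simp add: field_simps)
  moreover have "y * (1 + p * (1 - 1 / y)) \<le> y * (1 + p * ln y)"
    using ln assms by (intro mult_left_mono add_left_mono) auto
  ultimately show "1 + (p + 1) * (y - 1) \<le> y powr (p + 1)"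
    by linarith
  show "y = 1" if eq: "1 + (p + 1) * (y - 1) = y powr (p + 1)"
  proof -
    have "y * (1 + p * (1 - 1 / y)) = y * (1 + p * ln y)"
      using eq tan \<open>y * (1 + p * ln y) \<le> _\<close> \<open>y * (1 + p * (1 - 1 / y)) \<le> _\<close> by linarith
    then have "ln (1 / y) = 1 / y - 1"
      using assms by (simp add: ln_div)
    then show ?thesis
      using ln_eq_minus_one[of "1 / y"] assms by simp
  qed
qed

text \<open>Jensen's inequality for \<open>x powr (p + 1)\<close> in disguise. In the application
  \<open>F0\<close>, \<open>F1\<close> are values of the two functions at matched points and
  \<open>s0 powr (p + 1)\<close>, \<open>s1 powr (p + 1)\<close> are their total masses.\<close>

lemma weighted_mean_powr:
  fixes t p F0 F1 s0 s1 :: real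
  assumes t: "0 < t" "t < 1" and p: "0 < p"
    and pos: "0 < F0" "0 < F1" "0 < s0" "0 < s1"
  defines "L \<equiv> ((1 - t) * s0 + t * s1) powr (p + 1)"
    and "R \<equiv> ((1 - t) * F0 + t * F1) powr p *
      ((1 - t) * s0 powr (p + 1) / F0 powr p + t * s1 powr (p + 1) / F1 powr p)"
  shows "L \<le> R" and "L = R \<Longrightarrow> s0 * F1 = s1 * F0"
proof -
  define F where "F = (1 - t) * F0 + t * F1"
  define s where "s = (1 - t) * s0 + t * s1"
  \<comment> \<open>The quotients \<open>s0 / F0\<close> and \<open>s1 / F1\<close> are rescaled so
    that their mean under the weights \<open>l0\<close>, \<open>l1\<close> is 1. Then
    \<open>R / L\<close> is the weighted mean of \<open>y0 powr (p + 1)\<close> and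
    \<open>y1 powr (p + 1)\<close>.\<close>
  define y0 where "y0 = s0 * F / (F0 * s)"
  define y1 where "y1 = s1 * F / (F1 * s)"
  define l0 where "l0 = (1 - t) * F0 / F"
  define l1 where "l1 = t * F1 / F"
  have F: "0 < F" and s: "0 < s"
    unfolding F_def s_def using t pos by (auto intro!: add_pos_pos)
  have y: "0 < y0" "0 < y1" and l: "0 < l0" "0 < l1"
    unfolding y0_def y1_def l0_def l1_def using F s t pos by auto
  have l_sum: "l0 + l1 = 1"
    unfolding l0_def l1_def using F by (simp add: F_def flip: add_divide_distrib)
  have "l0 * y0 + l1 * y1 = ((1 - t) * s0 + t * s1) / s"
    unfolding l0_def l1_def y0_def y1_def using F s pos by (simp add: field_simps)
  then have ly_sum: "l0 * y0 + l1 * y1 = 1"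
    using s by (simp add: s_def)
  have summand: "s powr (p + 1) * (G / F * (r * F / (G * s)) powr (p + 1)) = F powr p * (r powr (p + 1) / G powr p)"
    if "0 < G" "0 < r" for G r
    using that F s by (simp add: powr_divide powr_mult powr_add field_simps)
  have "R = (1 - t) * (F powr p * (s0 powr (p + 1) / F0 powr p))
      + t * (F powr p * (s1 powr (p + 1) / F1 powr p))"
    unfolding R_def F_def[symmetric] by (simp add: algebra_simps)
  also have "\<dots> = (1 - t) * (s powr (p + 1) * (F0 / F * y0 powr (p + 1)))
      + t * (s powr (p + 1) * (F1 / F * y1 powr (p + 1)))"
    unfolding y0_def y1_def using pos by (simp only: summand)
  also have "\<dots> = s powr (p + 1) * (l0 * y0 powr (p + 1) + l1 * y1 powr (p + 1))"
    by (simp add: l0_def l1_def distrib_left mult.left_commute mult.assoc)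
  finally have R: "R = s powr (p + 1) * (l0 * y0 powr (p + 1) + l1 * y1 powr (p + 1))" .
  have L: "L = s powr (p + 1)"
    by (simp add: L_def s_def)
  note b0 = mult_left_mono[OF powr_above_tangent(1)[OF y(1) p] less_imp_le[OF l(1)]]
  note b1 = mult_left_mono[OF powr_above_tangent(1)[OF y(2) p] less_imp_le[OF l(2)]]
  \<comment> \<open>The tangent lines at 1 average to exactly 1, so the inequality follows from the
    two termwise bounds, and equality forces equality in each of them.\<close>
  have "l0 * (1 + (p + 1) * (y0 - 1)) + l1 * (1 + (p + 1) * (y1 - 1))
      = (l0 + l1) + (p + 1) * ((l0 * y0 + l1 * y1) - (l0 + l1))"
    by (simp add: algebra_simps)
  then have one: "l0 * (1 + (p + 1) * (y0 - 1)) + l1 * (1 + (p + 1) * (y1 - 1)) = 1"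
    by (simp only: l_sum ly_sum) simp
  show "L \<le> R"
    unfolding L R using b0 b1 one s by simp
  show "s0 * F1 = s1 * F0" if "L = R"
  proof -
    have eq: "l0 * y0 powr (p + 1) + l1 * y1 powr (p + 1) = 1"
      using that s unfolding L R by simp
    have "l0 * (1 + (p + 1) * (y0 - 1)) = l0 * y0 powr (p + 1)"
      "l1 * (1 + (p + 1) * (y1 - 1)) = l1 * y1 powr (p + 1)"
      using b0 b1 one eq by linarith+
    then have "y0 = 1" "y1 = 1"
      using powr_above_tangent(2)[OF y(1) p] powr_above_tangent(2)[OF y(2) p] l by auto
    then have "s0 * F = F0 * s" "s1 * F = F1 * s"
      using pos s unfolding y0_def y1_def by (auto simp: field_simps)
    then have "(s0 * F) * (F1 * s) = (s1 * F) * (F0 * s)"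
      by simp
    then show ?thesis
      using F s by (simp add: ac_simps)
  qed
qed

text \<open>Follows from convexity of the inverse function \<open>x powr (1 / \<alpha>)\<close>,
  applied at \<open>A powr \<alpha>\<close> and \<open>B powr \<alpha>\<close>.\<close>

lemma weighted_mean_powr_le:
  fixes A B t \<alpha> :: real
  assumes "0 < A" "0 < B" "0 < t" "t < 1" "0 < \<alpha>" "\<alpha> \<le> 1"
  shows "(1 - t) * A powr \<alpha> + t * B powr \<alpha> \<le> ((1 - t) * A + t * B) powr \<alpha>"
proof -
  have "convex_on {0<..} (\<lambda>x :: real. x powr (1 / \<alpha>))"
    using assms by (intro powr_convex) simp
  then have "((1 - t) *\<^sub>R (A powr \<alpha>) + t *\<^sub>R (B powr \<alpha>)) powr (1 / \<alpha>)
      \<le> (1 - t) * (A powr \<alpha>) powr (1 / \<alpha>) + t * (B powr \<alpha>) powr (1 / \<alpha>)"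
    using assms by (intro convex_onD) auto
  then have "((1 - t) * A powr \<alpha> + t * B powr \<alpha>) powr (1 / \<alpha>) \<le> (1 - t) * A + t * B"
    using assms by (simp add: powr_powr)
  then have "(((1 - t) * A powr \<alpha> + t * B powr \<alpha>) powr (1 / \<alpha>)) powr \<alpha> \<le> ((1 - t) * A + t * B) powr \<alpha>"
    using assms by (intro powr_mono2) auto
  then show ?thesis
    using assms by (simp add: powr_powr)
qed

section \<open>Monotone transport on the line\<close>

text \<open>Continuity of \<open>f\<close> is asked for only inside, since a concave function
  extended by zero may jump at the ends of its interval. Monotonicity reaches the end points through
  continuity of \<open>G\<close>.\<close>

lemma indefinite_integral_pos:
  fixes f :: "real \<Rightarrow> real"
  assumes ab: "a < b" and int: "f integrable_on {a..b}"
    and cont: "continuous_on {a<..<b} f" and pos: "\<forall>x\<in>{a<..<b}. 0 < f x"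
  defines "G \<equiv> \<lambda>x. integral {a..x} f"
  shows "continuous_on {a..b} G"
    and "\<And>x. x \<in> {a<..<b} \<Longrightarrow> (G has_real_derivative f x) (at x)"
    and "strict_mono_on {a..b} G"
proof -
  show c: "continuous_on {a..b} G"
    unfolding G_def by (rule indefinite_integral_continuous_1[OF int])
  show d: "(G has_real_derivative f x) (at x)" if x: "x \<in> {a<..<b}" for x
  proof -
    have "isCont f x"
      using cont x by (simp add: continuous_on_eq_continuous_at)
    then have "(G has_vector_derivative f x) (at x within {a..b} - {})"
      unfolding G_def using x
      by (intro integral_has_vector_derivative_continuous_at[OF int])
        (auto simp: continuous_at_imp_continuous_at_within)
    then have "(G has_vector_derivative f x) (at x within {a<..<b})"
      by (rule has_vector_derivative_within_subset) auto
    then show ?thesis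
      using x at_within_open[of x "{a<..<b}"] 
      by (simp add: has_real_derivative_iff_has_vector_derivative)
  qed
  show "strict_mono_on {a..b} G"
  proof (rule strict_mono_onI)
    fix x y assume xy: "x \<in> {a..b}" "y \<in> {a..b}" "x < y"
    show "G x < G y"
    proof (rule DERIV_pos_imp_increasing_open[OF \<open>x < y\<close>])
      show "\<exists>z. DERIV G w :> z \<and> 0 < z" if "x < w" "w < y" for w
        using d[of w] pos that xy by auto
      show "continuous_on {x..y} G"
        using c by (rule continuous_on_subset) (use xy in auto)
    qed
  qed
qed

text \<open>\<open>T\<close> matches proportions of mass: with primitives \<open>G0\<close>,
  \<open>G1\<close> and total masses \<open>S0\<close>, \<open>S1\<close> it solves
  \<open>G1 (T x) = S1 / S0 * G0 x\<close>. Differentiating this relation gives the formula for the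
  derivative.\<close>

lemma monotone_transport:
  fixes f0 f1 :: "real \<Rightarrow> real"
  assumes ab0: "a0 < b0" and int0: "f0 integrable_on {a0..b0}"
    and cont0: "continuous_on {a0<..<b0} f0" and pos0: "\<forall>x\<in>{a0<..<b0}. 0 < f0 x"
    and ab1: "a1 < b1" and int1: "f1 integrable_on {a1..b1}"
    and cont1: "continuous_on {a1<..<b1} f1" and pos1: "\<forall>x\<in>{a1<..<b1}. 0 < f1 x"
  obtains T where "continuous_on {a0..b0} T" "T a0 = a1" "T b0 = b1"
    "\<And>x. x \<in> {a0<..<b0} \<Longrightarrow> T x \<in> {a1<..<b1}"
    "\<And>x. x \<in> {a0<..<b0} \<Longrightarrow>
      (T has_real_derivative integral {a1..b1} f1 * f0 x / (integral {a0..b0} f0 * f1 (T x))) (at x)"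
proof -
  define G0 where "G0 = (\<lambda>x. integral {a0..x} f0)"
  define G1 where "G1 = (\<lambda>x. integral {a1..x} f1)"
  note G0 = indefinite_integral_pos[OF ab0 int0 cont0 pos0, folded G0_def]
  note G1 = indefinite_integral_pos[OF ab1 int1 cont1 pos1, folded G1_def]
  define S0 where "S0 = G0 b0"
  define S1 where "S1 = G1 b1"
  have G0a: "G0 a0 = 0" and G1a: "G1 a1 = 0"
    by (auto simp: G0_def G1_def)
  have S0: "0 < S0" and S1: "0 < S1"
    using strict_mono_onD[OF G0(3), of a0 b0] strict_mono_onD[OF G1(3), of a1 b1] ab0 ab1 G0a G1a
    by (auto simp: S0_def S1_def)
  have inj1: "inj_on G1 {a1..b1}"
    using G1(3) by (rule strict_mono_on_imp_inj_on)
  define g where "g = inv_into {a1..b1} G1"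
  have img: "G1 ` {a1..b1} = {0..S1}"
  proof (rule antisym)
    show "G1 ` {a1..b1} \<subseteq> {0..S1}"
      using strict_mono_on_leD[OF G1(3), of a1] strict_mono_on_leD[OF G1(3), of _ b1] ab1
      by (auto simp: S1_def simp flip: G1a)
    show "{0..S1} \<subseteq> G1 ` {a1..b1}"
    proof
      fix y assume "y \<in> {0..S1}"
      then show "y \<in> G1 ` {a1..b1}"
        using IVT'[of G1 a1 y b1] G1(1) ab1 G1a by (force simp: S1_def)
    qed
  qed
  have g_mem: "g y \<in> {a1..b1}" and Gg: "G1 (g y) = y" if "y \<in> {0..S1}" for y
    using that img inv_into_into[of y G1 "{a1..b1}"] f_inv_into_f[of y G1 "{a1..b1}"] by (auto simp: g_def)
  have gG: "g (G1 x) = x" if "x \<in> {a1..b1}" for x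
    using inv_into_f_f[OF inj1 that] by (simp add: g_def)
  have g_cont: "continuous_on {0..S1} g"
    using continuous_on_inv[OF G1(1) compact_Icc, of g] gG img by simp
  have g_open: "g y \<in> {a1<..<b1}" if y: "y \<in> {0<..<S1}" for y
  proof -
    have "g y \<noteq> a1" "g y \<noteq> b1"
      using y Gg[of y] G1a by (auto simp: S1_def)
    then show ?thesis
      using g_mem[of y] y by auto
  qed
  have g_deriv: "(g has_real_derivative inverse (f1 (g y))) (at y)" if y: "y \<in> {0<..<S1}" for y
  proof (rule DERIV_inverse_function)
    show "(G1 has_real_derivative f1 (g y)) (at (g y))"
      by (rule G1(2)[OF g_open[OF y]])
    show "f1 (g y) \<noteq> 0"
      using pos1 g_open[OF y] by fastforce
    show "0 < y" "y < S1" using y by auto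
    show "G1 (g z) = z" if "0 < z" "z < S1" for z
      using that by (intro Gg) auto
    show "isCont g y"
      using continuous_on_interior[OF g_cont, of y] y by simp
  qed
  define k where "k = S1 / S0"
  have k: "0 < k" using S0 S1 by (simp add: k_def)
  define T where "T = (\<lambda>x. g (k * G0 x))"
  have kS0: "k * S0 = S1" using S0 by (simp add: k_def)
  have kG0_mem: "k * G0 x \<in> {0..S1}" if "x \<in> {a0..b0}" for x
    using strict_mono_on_leD[OF G0(3), of a0 x] strict_mono_on_leD[OF G0(3), of x b0] that ab0 k G0a
    by (auto simp: S0_def simp flip: kS0)
  have kG0_open: "k * G0 x \<in> {0<..<S1}" if "x \<in> {a0<..<b0}" for x
    using strict_mono_onD[OF G0(3), of a0 x] strict_mono_onD[OF G0(3), of x b0] that ab0 k G0a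
    by (auto simp: S0_def simp flip: kS0)
  show ?thesis
  proof
    show "continuous_on {a0..b0} T"
      unfolding T_def
      by (rule continuous_on_compose2[OF g_cont]) (use kG0_mem in \<open>auto intro!: continuous_intros G0(1)\<close>)
    show "T a0 = a1"
      using gG[of a1] ab1 by (simp add: T_def G0a G1a)
    show "T b0 = b1"
      using gG[of b1] ab1 kS0 by (simp add: T_def S0_def S1_def)
    show "T x \<in> {a1<..<b1}" if "x \<in> {a0<..<b0}" for x
      unfolding T_def by (rule g_open[OF kG0_open[OF that]])
    show "(T has_real_derivative integral {a1..b1} f1 * f0 x / (integral {a0..b0} f0 * f1 (T x))) (at x)"
      if x: "x \<in> {a0<..<b0}" for x
    proof -
      have "(T has_real_derivative inverse (f1 (g (k * G0 x))) * (k * f0 x)) (at x)"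
        unfolding T_def
        by (rule DERIV_chain2[where f = g and g = "\<lambda>x. k * G0 x", OF g_deriv[OF kG0_open[OF x]]])
          (intro DERIV_cmult G0(2) x)
      then show ?thesis
        by (simp add: T_def k_def S0_def S1_def G0_def G1_def divide_inverse ac_simps)
    qed
  qed
qed

text \<open>The mass of \<open>F0 powr p\<close> is carried along
  \<open>Z x = (1 - t) * x + t * T x\<close>, with \<open>T\<close> the monotone transport. By
  \<open>weighted_mean_powr\<close> the mass of \<open>H powr p\<close> is swept at least
  \<open>M / S0\<close> times as fast, and integrating this comparison gives the bound.\<close>

lemma interval_brunn_minkowski:
  fixes F0 F1 H :: "real \<Rightarrow> real" and a0 b0 a1 b1 c d t p :: real
  assumes t: "0 < t" "t < 1" and p: "0 < p"
    and ab0: "a0 < b0" and int0: "(\<lambda>x. F0 x powr p) integrable_on {a0..b0}"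
    and cont0: "continuous_on {a0<..<b0} F0" and pos0: "\<forall>x\<in>{a0<..<b0}. 0 < F0 x"
    and ab1: "a1 < b1" and int1: "(\<lambda>x. F1 x powr p) integrable_on {a1..b1}"
    and cont1: "continuous_on {a1<..<b1} F1" and pos1: "\<forall>x\<in>{a1<..<b1}. 0 < F1 x"
    and cd: "c < d" and intH: "(\<lambda>x. H x powr p) integrable_on {c..d}"
    and contH: "continuous_on {c<..<d} H" and posH: "\<forall>x\<in>{c<..<d}. 0 < H x"
    and mem: "\<And>x y. x \<in> {a0<..<b0} \<Longrightarrow> y \<in> {a1<..<b1} \<Longrightarrow> (1 - t) * x + t * y \<in> {c<..<d}"
    and le: "\<And>x y. x \<in> {a0<..<b0} \<Longrightarrow> y \<in> {a1<..<b1} \<Longrightarrow>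
      (1 - t) * F0 x + t * F1 y \<le> H ((1 - t) * x + t * y)"
  defines "S0 \<equiv> integral {a0..b0} (\<lambda>x. F0 x powr p)"
    and "S1 \<equiv> integral {a1..b1} (\<lambda>x. F1 x powr p)"
    and "SH \<equiv> integral {c..d} (\<lambda>x. H x powr p)"
  shows "((1 - t) * S0 powr (1 / (p + 1)) + t * S1 powr (1 / (p + 1))) powr (p + 1) \<le> SH"
    and "\<lbrakk>a0 = a1; b0 = b1; S0 = S1; SH = S0; x \<in> {a0<..<b0}\<rbrakk> \<Longrightarrow> F0 x = F1 x"
proof -
  have contp: "continuous_on A (\<lambda>x. F x powr p)"
    if "continuous_on A F" "\<forall>x\<in>A. 0 < F x" for A :: "real set" and F
    using that by (intro continuous_intros) auto
  have posp: "\<forall>x\<in>A. 0 < F x powr p" if "\<forall>x\<in>A. 0 < F x" for A :: "real set" and F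
    using that by auto
  note I0 = indefinite_integral_pos[OF ab0 int0 contp[OF cont0 pos0] posp[OF pos0]]
  note I1 = indefinite_integral_pos[OF ab1 int1 contp[OF cont1 pos1] posp[OF pos1]]
  note IH = indefinite_integral_pos[OF cd intH contp[OF contH posH] posp[OF posH]]
  have S0: "0 < S0" and S1: "0 < S1"
    using strict_mono_onD[OF I0(3), of a0 b0] strict_mono_onD[OF I1(3), of a1 b1] ab0 ab1
    by (auto simp: S0_def S1_def)
  define s0 where "s0 = S0 powr (1 / (p + 1))"
  define s1 where "s1 = S1 powr (1 / (p + 1))"
  have s: "0 < s0" "0 < s1" using S0 S1 by (auto simp: s0_def s1_def)
  have s_powr: "s0 powr (p + 1) = S0" "s1 powr (p + 1) = S1"
    using S0 S1 p by (auto simp: s0_def s1_def powr_powr)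
  define M where "M = ((1 - t) * s0 + t * s1) powr (p + 1)"
  obtain T where T: "continuous_on {a0..b0} T" "T a0 = a1" "T b0 = b1"
    "\<And>x. x \<in> {a0<..<b0} \<Longrightarrow> T x \<in> {a1<..<b1}"
    "\<And>x. x \<in> {a0<..<b0} \<Longrightarrow>
      (T has_real_derivative S1 * F0 x powr p / (S0 * F1 (T x) powr p)) (at x)"
    using monotone_transport[OF ab0 int0 contp[OF cont0 pos0] posp[OF pos0]
        ab1 int1 contp[OF cont1 pos1] posp[OF pos1]]
    unfolding S0_def S1_def by blast
  define G where "G x = integral {a0..x} (\<lambda>x. F0 x powr p)" for x
  define K where "K x = integral {c..x} (\<lambda>x. H x powr p)" for x
  define Z where "Z x = (1 - t) * x + t * T x" for x
  \<comment> \<open>\<open>K (Z x) - K (Z a0)\<close> is the mass of \<open>H powr p\<close> swept while \<open>G x\<close> of \<open>F0 powr p\<close> is swept;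
    \<open>\<Psi>\<close> being nondecreasing is the claim, and in the equality case \<open>\<Psi>\<close> vanishes identically.\<close>
  define \<Psi> where "\<Psi> x = K (Z x) - M / S0 * G x" for x
  have Z_open: "Z x \<in> {c<..<d}" if "x \<in> {a0<..<b0}" for x
    unfolding Z_def using that T(4) by (intro mem) auto
  have Z_cont: "continuous_on {a0..b0} Z"
    unfolding Z_def by (intro continuous_intros T)
  have Z_mem: "Z ` {a0..b0} \<subseteq> {c..d}"
    using image_closure_subset[of "{a0<..<b0}" Z "{c..d}"] Z_cont Z_open ab0 by fastforce
  have \<Psi>_cont: "continuous_on {a0..b0} \<Psi>"
    unfolding \<Psi>_def
    by (intro continuous_intros continuous_on_compose2[OF _ Z_cont Z_mem, of K])
      (use I0(1) IH(1) in \<open>auto simp: G_def[abs_def] K_def[abs_def]\<close>)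
  define D where "D x = H (Z x) powr p * ((1 - t) + t * (S1 * F0 x powr p / (S0 * F1 (T x) powr p)))
      - M / S0 * F0 x powr p" for x
  have \<Psi>_deriv: "(\<Psi> has_real_derivative D x) (at x)" if x: "x \<in> {a0<..<b0}" for x
    unfolding \<Psi>_def D_def
  proof (intro DERIV_diff DERIV_cmult)
    have "(Z has_real_derivative (1 - t) + t * (S1 * F0 x powr p / (S0 * F1 (T x) powr p))) (at x)"
      unfolding Z_def by (auto intro!: derivative_eq_intros T(5) x)
    moreover have "(K has_real_derivative H (Z x) powr p) (at (Z x))"
      unfolding K_def[abs_def] by (rule IH(2)[OF Z_open[OF x]])
    ultimately show "((\<lambda>x. K (Z x)) has_real_derivative
        H (Z x) powr p * ((1 - t) + t * (S1 * F0 x powr p / (S0 * F1 (T x) powr p)))) (at x)"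
      using DERIV_chain2 by blast
    show "(G has_real_derivative F0 x powr p) (at x)"
      unfolding G_def[abs_def] by (rule I0(2)[OF x])
  qed
  \<comment> \<open>Replacing \<open>H (Z x)\<close> by its lower bound
    \<open>(1 - t) * F0 x + t * F1 (T x)\<close> turns the swept density into
    \<open>F0 x powr p / S0 * R x\<close>, a form to which \<open>weighted_mean_powr\<close>
    applies.\<close>
  define R where "R x = ((1 - t) * F0 x + t * F1 (T x)) powr p *
      ((1 - t) * s0 powr (p + 1) / F0 x powr p + t * s1 powr (p + 1) / F1 (T x) powr p)" for x
  have D_ge: "F0 x powr p / S0 * (R x - M) \<le> D x" and R_ge: "M \<le> R x"
    and R_eq: "R x = M \<Longrightarrow> s0 * F1 (T x) = s1 * F0 x" if x: "x \<in> {a0<..<b0}" for x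
  proof -
    have F: "0 < F0 x" "0 < F1 (T x)"
      using x pos0 pos1 T(4) by auto
    show "M \<le> R x" and "R x = M \<Longrightarrow> s0 * F1 (T x) = s1 * F0 x"
      using weighted_mean_powr[OF t p F s] unfolding M_def R_def by auto
    have "((1 - t) * F0 x + t * F1 (T x)) powr p \<le> H (Z x) powr p"
      unfolding Z_def using le[OF x T(4)[OF x]] F t p by (intro powr_mono2) auto
    then have "((1 - t) * F0 x + t * F1 (T x)) powr p *
        ((1 - t) + t * (S1 * F0 x powr p / (S0 * F1 (T x) powr p))) - M / S0 * F0 x powr p \<le> D x"
      unfolding D_def using t S0 S1 by (intro diff_right_mono mult_right_mono) auto
    moreover have "F0 x powr p / S0 * R x = ((1 - t) * F0 x + t * F1 (T x)) powr p *
        ((1 - t) + t * (S1 * F0 x powr p / (S0 * F1 (T x) powr p)))"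
    proof -
      have "F0 x powr p / S0 * ((1 - t) * S0 / F0 x powr p + t * S1 / F1 (T x) powr p)
          = (1 - t) + t * (S1 * F0 x powr p / (S0 * F1 (T x) powr p))"
        using F S0 by (simp add: field_simps)
      from this[symmetric] show ?thesis
        unfolding R_def s_powr by (simp only: mult.left_commute)
    qed
    ultimately show "F0 x powr p / S0 * (R x - M) \<le> D x"
      by (simp add: right_diff_distrib mult.commute[of M])
  qed
  have D_nonneg: "0 \<le> D x" if "x \<in> {a0<..<b0}" for x
  proof -
    have "0 \<le> F0 x powr p / S0 * (R x - M)"
      using R_ge[OF that] S0 by simp
    then show ?thesis using D_ge[OF that] by linarith
  qed
  have mono: "\<Psi> x \<le> \<Psi> y" if "a0 \<le> x" "x \<le> y" "y \<le> b0" for x y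
  proof (rule DERIV_nonneg_imp_increasing_open[OF \<open>x \<le> y\<close>])
    show "\<exists>z. DERIV \<Psi> w :> z \<and> 0 \<le> z" if "x < w" "w < y" for w
      using that \<open>a0 \<le> x\<close> \<open>y \<le> b0\<close> by (intro exI[of _ "D w"] conjI \<Psi>_deriv D_nonneg) auto
    show "continuous_on {x..y} \<Psi>"
      using that by (intro continuous_on_subset[OF \<Psi>_cont]) auto
  qed
  have K_mono: "K y \<le> K z" if "c \<le> y" "y \<le> z" "z \<le> d" for y z
    using strict_mono_on_leD[OF IH(3), of y z] that unfolding K_def by auto
  \<comment> \<open>The range of \<open>Z\<close> only has to lie in \<open>{c..d}\<close>: mass of
    \<open>H powr p\<close> that is not swept works in favour of the inequality.\<close>
  have "0 \<le> K (Z a0)"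
    using K_mono[of c "Z a0"] Z_mem ab0 by (auto simp: K_def image_subset_iff)
  then have lo: "0 \<le> \<Psi> a0"
    by (simp add: \<Psi>_def G_def)
  have "K (Z b0) \<le> K d"
    using K_mono[of "Z b0" d] Z_mem ab0 by (auto simp: image_subset_iff)
  then have hi: "\<Psi> b0 \<le> SH - M"
    using S0 by (simp add: \<Psi>_def G_def K_def SH_def flip: S0_def)
  show "((1 - t) * S0 powr (1 / (p + 1)) + t * S1 powr (1 / (p + 1))) powr (p + 1) \<le> SH"
    using mono[of a0 b0] ab0 lo hi by (simp add: M_def s0_def s1_def)
  show "F0 x = F1 x"
    if eq: "a0 = a1" "b0 = b1" "S0 = S1" "SH = S0" and x: "x \<in> {a0<..<b0}"
  proof -
    have s_eq: "s0 = s1" by (simp add: s0_def s1_def eq(3))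
    have "M = S0"
      unfolding M_def s_powr(1)[symmetric] s_eq by (simp add: algebra_simps)
    \<comment> \<open>\<open>\<Psi>\<close> is nondecreasing, starts at a value at least 0 and ends
      at one at most \<open>SH - M = 0\<close>.\<close>
    then have zero: "\<Psi> y = 0" if "y \<in> {a0..b0}" for y
      using mono[of a0 y] mono[of y b0] that lo hi eq(4) by auto
    \<comment> \<open>A vanishing derivative \<open>D y\<close> squeezes \<open>R y\<close> down to
      \<open>M\<close>; the equality case of \<open>weighted_mean_powr\<close> with
      \<open>s0 = s1\<close> then matches the two functions along \<open>T\<close>.\<close>
    have F1T: "F1 (T y) = F0 y" if y: "y \<in> {a0<..<b0}" for y
    proof -
      have "eventually (\<lambda>z. z \<in> {a0<..<b0}) (nhds y)"
        using y by (intro eventually_nhds_in_open) auto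
      then have "eventually (\<lambda>z. \<Psi> z = 0) (nhds y)"
        by eventually_elim (auto intro: zero)
      then have "((\<lambda>_. 0) has_real_derivative D y) (at y)"
        using DERIV_cong_ev[OF refl _ refl, of \<Psi> "\<lambda>_. 0" y "D y"] \<Psi>_deriv[OF y] by simp
      then have "D y = 0"
        using DERIV_unique[OF _ DERIV_const] by metis
      then have "F0 y powr p / S0 * (R y - M) \<le> 0"
        using D_ge[OF y] by simp
      moreover have "0 < F0 y powr p / S0"
        using S0 bspec[OF pos0 y] by simp
      ultimately have "R y - M \<le> 0"
        by (metis mult_pos_pos not_le)
      then show ?thesis
        using R_ge[OF y] R_eq[OF y] s_eq s by simp
    qed
    \<comment> \<open>With equal masses and \<open>F1 (T y) = F0 y\<close> the transport density is
      1, so \<open>T y - y\<close> is constant; it vanishes at the common left end point, hence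
      \<open>T\<close> is the identity.\<close>
    have "(T has_real_derivative 1) (at y)" if y: "y \<in> {a0<..<b0}" for y
    proof -
      have "0 < F0 y" using bspec[OF pos0 y] .
      then show ?thesis using T(5)[OF y] F1T[OF y] S0 eq(3) by simp
    qed
    then have "((\<lambda>y. T y - y) has_real_derivative 0) (at y)" if "a0 < y" "y < b0" for y
      using that by (auto intro!: derivative_eq_intros)
    moreover have "continuous_on {a0..b0} (\<lambda>y. T y - y)"
      by (intro continuous_intros T)
    ultimately have "T x - x = T a0 - a0"
      using DERIV_isconst2[OF ab0, of "\<lambda>y. T y - y" x] x by auto
    then show ?thesis
      using F1T[OF x] T(2) eq(1) by simp
  qed
qed

section \<open>Integrating out one direction\<close>

text \<open>The cylinder over the projection of \<Omega> along \<open>b\<close>. It plays the role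
  of the projection without leaving the ambient space.\<close>

definition shadow :: "'a::real_vector \<Rightarrow> 'a set \<Rightarrow> 'a set" where
  "shadow b \<Omega> = {x. \<exists>r. x + r *\<^sub>R b \<in> \<Omega>}"

text \<open>Vanishing off \<Omega> lets all integrals run over whole lines or the whole space, and
  the upper bound keeps them finite on bounded slices. Boundedness of \<Omega> is left out because
  shadows are unbounded.\<close>

definition positive_concave :: "'a::euclidean_space set \<Rightarrow> ('a \<Rightarrow> real) \<Rightarrow> bool" where
  "positive_concave \<Omega> f \<longleftrightarrow> open \<Omega> \<and> concave_on \<Omega> f \<and> (\<forall>x\<in>\<Omega>. 0 < f x) \<and>
    (\<forall>x. x \<notin> \<Omega> \<longrightarrow> f x = 0) \<and> bdd_above (range f)"

text \<open>With the exponent \<open>1 / (p + 1)\<close>, one integration turns the pair (concave function, power \<open>p\<close>)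
  into (concave function, power \<open>p + 1\<close>).\<close>

definition marginal :: "'a::euclidean_space \<Rightarrow> real \<Rightarrow> ('a \<Rightarrow> real) \<Rightarrow> 'a \<Rightarrow> real" where
  "marginal b p f x = (\<integral>r. f (x + r *\<^sub>R b) powr p \<partial>lborel) powr (1 / (p + 1))"

section \<open>Shadows, slices and their regularity\<close>

lemma open_shadow: "open (shadow b \<Omega>)" if "open \<Omega>" for \<Omega> :: "'a::real_normed_vector set"
proof -
  have "shadow b \<Omega> = (\<Union>r. (\<lambda>x. x + r *\<^sub>R b) -` \<Omega>)"
    by (auto simp: shadow_def)
  moreover have "open ((\<lambda>x. x + r *\<^sub>R b) -` \<Omega>)" for r
    by (intro continuous_open_vimage that continuous_intros)
  ultimately show ?thesis by auto
qed

lemma convex_shadow: "convex (shadow b \<Omega>)" if "convex \<Omega>"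
proof (rule convexI)
  fix x y and u v :: real
  assume "x \<in> shadow b \<Omega>" "y \<in> shadow b \<Omega>" and uv: "0 \<le> u" "0 \<le> v" "u + v = 1"
  then obtain r s where "x + r *\<^sub>R b \<in> \<Omega>" "y + s *\<^sub>R b \<in> \<Omega>"
    by (auto simp: shadow_def)
  then have "u *\<^sub>R (x + r *\<^sub>R b) + v *\<^sub>R (y + s *\<^sub>R b) \<in> \<Omega>"
    using that uv by (intro convexD)
  then have "(u *\<^sub>R x + v *\<^sub>R y) + (u * r + v * s) *\<^sub>R b \<in> \<Omega>"
    by (simp add: algebra_simps)
  then show "u *\<^sub>R x + v *\<^sub>R y \<in> shadow b \<Omega>"
    unfolding shadow_def by blast
qed

lemma subset_shadow: "\<Omega> \<subseteq> shadow b \<Omega>"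
  unfolding shadow_def by (auto intro: exI[of _ 0])

text \<open>A shadow is unbounded along \<open>b\<close>, so boundedness is tracked one coordinate
  at a time; a coordinate orthogonal to \<open>b\<close> is constant on each line in direction
  \<open>b\<close>.\<close>

lemma bounded_shadow:
  assumes "bounded ((\<lambda>x. x \<bullet> c) ` \<Omega>)" "b \<bullet> c = 0"
  shows "bounded ((\<lambda>x. x \<bullet> c) ` shadow b \<Omega>)"
proof -
  have "(\<lambda>x. x \<bullet> c) ` shadow b \<Omega> \<subseteq> (\<lambda>x. x \<bullet> c) ` \<Omega>"
  proof (clarify, unfold shadow_def, clarify)
    fix x r assume "x + r *\<^sub>R b \<in> \<Omega>"
    moreover have "x \<bullet> c = (x + r *\<^sub>R b) \<bullet> c"
      using assms(2) by (simp add: inner_add_left)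
    ultimately show "x \<bullet> c \<in> (\<lambda>x. x \<bullet> c) ` \<Omega>" by blast
  qed
  then show ?thesis using assms(1) bounded_subset by blast
qed

lemma open_convex_real_eq_interval:
  fixes S :: "real set"
  assumes "open S" "convex S" "bounded S" "S \<noteq> {}"
  obtains a b where "a < b" "S = {a<..<b}"
proof -
  have bdd: "bdd_below S" "bdd_above S"
    using assms(3) by (auto simp: bounded_imp_bdd_below bounded_imp_bdd_above)
  have "S = {Inf S<..<Sup S}"
  proof (intro set_eqI iffI)
    fix x assume x: "x \<in> S"
    then obtain e where e: "0 < e" "\<forall>y. dist y x < e \<longrightarrow> y \<in> S"
      using assms(1) unfolding open_dist by blast
    have "x - e / 2 \<in> S" "x + e / 2 \<in> S"
      using e by (auto simp: dist_real_def)
    then have "Inf S \<le> x - e / 2" "x + e / 2 \<le> Sup S"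
      using bdd by (auto intro: cInf_lower cSup_upper)
    then show "x \<in> {Inf S<..<Sup S}" using e(1) by auto
  next
    fix x assume "x \<in> {Inf S<..<Sup S}"
    then obtain y z where "y \<in> S" "y < x" "z \<in> S" "x < z"
      using assms(4) bdd by (auto simp: cInf_less_iff less_cSup_iff)
    moreover have "is_interval S"
      using assms(2) by (simp add: is_interval_convex_1)
    ultimately show "x \<in> S"
      unfolding is_interval_1 by (meson less_imp_le)
  qed
  moreover from this have "Inf S < Sup S"
    using assms(4) by (metis greaterThanLessThan_empty_iff not_le)
  ultimately show ?thesis using that by blast
qed

text \<open>A concave function on an open set of a Euclidean space is continuous there, and
  extending it by zero keeps it Borel.\<close>

lemma positive_concave_measurable:
  assumes "positive_concave \<Omega> f"
  shows "f \<in> borel_measurable borel"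
proof -
  have "continuous_on \<Omega> (\<lambda>x. - f x)"
    using assms by (intro convex_on_continuous) (auto simp: positive_concave_def concave_on_def)
  then have "continuous_on \<Omega> f"
    using continuous_on_minus[of \<Omega> "\<lambda>x. - f x"] by simp
  then have "(\<lambda>x. indicator \<Omega> x *\<^sub>R f x) \<in> borel_measurable borel"
    using assms by (intro borel_measurable_continuous_on_indicator) (auto simp: positive_concave_def)
  also have "(\<lambda>x. indicator \<Omega> x *\<^sub>R f x) = f"
    using assms by (auto simp: positive_concave_def fun_eq_iff indicator_def)
  finally show ?thesis .
qed

lemma positive_concave_nonneg: "positive_concave \<Omega> f \<Longrightarrow> 0 \<le> f x"
  unfolding positive_concave_def by (cases "x \<in> \<Omega>") (auto intro: less_imp_le)

text \<open>The width bound does not depend on \<open>x\<close>; it is what makes marginals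
  bounded.\<close>

lemma slice_interval:
  assumes "open \<Omega>" "convex \<Omega>" and b: "b \<in> Basis" and bdd: "\<forall>x\<in>\<Omega>. \<bar>x \<bullet> b\<bar> \<le> K"
    and x: "x \<in> shadow b \<Omega>"
  obtains a c where "a < c" "c - a \<le> 2 * K" "{r. x + r *\<^sub>R b \<in> \<Omega>} = {a<..<c}"
proof -
  let ?S = "{r. x + r *\<^sub>R b \<in> \<Omega>}"
  have "open ((\<lambda>r. x + r *\<^sub>R b) -` \<Omega>)"
    by (intro continuous_open_vimage assms continuous_intros)
  then have "open ?S" by (simp add: vimage_def)
  moreover have "convex ?S"
  proof (rule convexI)
    fix r s u v :: real
    assume "r \<in> ?S" "s \<in> ?S" and uv: "0 \<le> u" "0 \<le> v" "u + v = 1"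
    then have "u *\<^sub>R (x + r *\<^sub>R b) + v *\<^sub>R (x + s *\<^sub>R b) \<in> \<Omega>"
      using assms(2) by (intro convexD) auto
    moreover have "u *\<^sub>R (x + r *\<^sub>R b) + v *\<^sub>R (x + s *\<^sub>R b) = (u + v) *\<^sub>R x + (u * r + v * s) *\<^sub>R b"
      by (simp add: algebra_simps)
    ultimately show "u *\<^sub>R r + v *\<^sub>R s \<in> ?S"
      using uv by simp
  qed
  moreover have mem: "r \<in> {- K - x \<bullet> b..K - x \<bullet> b}" if "r \<in> ?S" for r
    using bspec[OF bdd, of "x + r *\<^sub>R b"] that b by (auto simp: inner_add_left)
  then have "bounded ?S"
    by (meson bounded_closed_interval bounded_subset subsetI)
  moreover have "?S \<noteq> {}"
    using x by (auto simp: shadow_def)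
  ultimately obtain a c where ac: "a < c" "?S = {a<..<c}"
    by (rule open_convex_real_eq_interval)
  have "{a<..<c} \<subseteq> {- K - x \<bullet> b..K - x \<bullet> b}"
    using mem ac(2) by blast
  then have "c - a \<le> 2 * K"
    using ac(1) by (auto simp: greaterThanLessThan_subseteq_atLeastAtMost_iff)
  then show ?thesis using that ac by blast
qed

text \<open>Collects for one line what \<open>interval_brunn_minkowski\<close> asks of a function.
  The integral over \<open>{a..c}\<close> equals the one over the line because \<open>F\<close>
  vanishes off the open interval.\<close>

lemma slice_integral:
  assumes f: "positive_concave \<Omega> f" and p: "0 < p"
    and S: "{r. x + r *\<^sub>R b \<in> \<Omega>} = {a<..<c}" and ac: "a < c"
    and C: "\<And>x. f x \<le> C"
  defines "F \<equiv> \<lambda>r. f (x + r *\<^sub>R b)"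
  shows "continuous_on {a<..<c} F" "\<forall>r\<in>{a<..<c}. 0 < F r"
    "integrable lborel (\<lambda>r. F r powr p)"
    "(\<lambda>r. F r powr p) integrable_on {a..c}"
    "integral {a..c} (\<lambda>r. F r powr p) = (\<integral>r. F r powr p \<partial>lborel)"
    "(\<integral>r. F r powr p \<partial>lborel) \<le> C powr p * (c - a)"
    "0 < (\<integral>r. F r powr p \<partial>lborel)"
proof -
  have mem: "x + r *\<^sub>R b \<in> \<Omega> \<longleftrightarrow> r \<in> {a<..<c}" for r
    unfolding S[symmetric] by simp
  have "continuous_on \<Omega> (\<lambda>x. - f x)"
    using f by (intro convex_on_continuous) (auto simp: positive_concave_def concave_on_def)
  then have cont: "continuous_on \<Omega> f"
    using continuous_on_minus[of \<Omega> "\<lambda>x. - f x"] by simp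
  show contF: "continuous_on {a<..<c} F"
    unfolding F_def
  proof (rule continuous_on_compose2[OF cont])
    show "(\<lambda>r. x + r *\<^sub>R b) ` {a<..<c} \<subseteq> \<Omega>"
      using mem by blast
  qed (intro continuous_intros)
  show posF: "\<forall>r\<in>{a<..<c}. 0 < F r"
    unfolding F_def using f mem by (auto simp: positive_concave_def)
  have zeroF: "F r = 0" if "r \<notin> {a<..<c}" for r
    unfolding F_def using f mem that by (auto simp: positive_concave_def)
  note [measurable] = positive_concave_measurable[OF f]
  have bound: "F r powr p \<le> C powr p * indicator {a..c} r" for r
  proof (cases "r \<in> {a<..<c}")
    case True
    then have "F r powr p \<le> C powr p"
      using posF C p by (intro powr_mono2) (auto simp: F_def less_imp_le)
    then show ?thesis using True by (auto simp: indicator_def)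
  next
    case False
    then show ?thesis using zeroF[OF False] by simp
  qed
  have intC: "integrable lborel (\<lambda>r. C powr p * indicator {a..c} r :: real)"
    using ac by (intro integrable_mult_right integrable_real_indicator) auto
  show int: "integrable lborel (\<lambda>r. F r powr p)"
  proof (rule Bochner_Integration.integrable_bound[OF intC])
    show "(\<lambda>r. F r powr p) \<in> borel_measurable lborel"
      unfolding F_def by measurable
    show "AE r in lborel. norm (F r powr p) \<le> norm (C powr p * indicator {a..c} r :: real)"
      using bound by (auto simp: abs_mult intro!: AE_I2)
  qed
  have "(\<integral>r. F r powr p \<partial>lborel) \<le> (\<integral>r. C powr p * indicator {a..c} r \<partial>lborel)"
    using bound by (intro integral_mono int intC)
  then show "(\<integral>r. F r powr p \<partial>lborel) \<le> C powr p * (c - a)"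
    using ac by simp
  have "((\<lambda>r. if r \<in> {a..c} then F r powr p else 0) has_integral (\<integral>r. F r powr p \<partial>lborel)) UNIV"
    by (rule has_integral_eq[OF _ has_integral_integral_lborel[OF int]]) (use zeroF in auto)
  then have "((\<lambda>r. F r powr p) has_integral (\<integral>r. F r powr p \<partial>lborel)) {a..c}"
    by (simp only: has_integral_restrict_UNIV)
  then show io: "(\<lambda>r. F r powr p) integrable_on {a..c}"
    and eq: "integral {a..c} (\<lambda>r. F r powr p) = (\<integral>r. F r powr p \<partial>lborel)"
    by (auto simp: has_integral_iff)
  have "strict_mono_on {a..c} (\<lambda>x. integral {a..x} (\<lambda>r. F r powr p))"
    using posF by (intro indefinite_integral_pos(3)[OF ac io]) (auto intro!: continuous_intros contF)
  from strict_mono_onD[OF this, of a c] show "0 < (\<integral>r. F r powr p \<partial>lborel)"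
    using ac eq by simp
qed

section \<open>Passing the inequality and its equality case to marginals\<close>

text \<open>Points with parameters \<open>r\<close>, \<open>s\<close> on the lines through
  \<open>x\<close> and \<open>y\<close> combine to the point with parameter
  \<open>(1 - t) * r + t * s\<close> on the line through the combined point, so the one-dimensional
  inequality applies to three slices. For equality all three slices are taken on the same
  line.\<close>

lemma marginal_brunn_minkowski:
  assumes f0: "positive_concave \<Omega> f0" and f1: "positive_concave \<Omega> f1" and h: "positive_concave \<Omega> h"
    and b: "b \<in> Basis" and bdd: "bounded ((\<lambda>x. x \<bullet> b) ` \<Omega>)"
    and t: "0 < t" "t < 1" and p: "0 < p"
    and le: "\<And>x y. x \<in> \<Omega> \<Longrightarrow> y \<in> \<Omega> \<Longrightarrow>
      (1 - t) * f0 x + t * f1 y \<le> h ((1 - t) *\<^sub>R x + t *\<^sub>R y)"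
  shows "x \<in> shadow b \<Omega> \<Longrightarrow> y \<in> shadow b \<Omega> \<Longrightarrow>
      (1 - t) * marginal b p f0 x + t * marginal b p f1 y \<le> marginal b p h ((1 - t) *\<^sub>R x + t *\<^sub>R y)"
    and "(\<And>x. x \<in> shadow b \<Omega> \<Longrightarrow> marginal b p f0 x = marginal b p f1 x) \<Longrightarrow>
      (\<And>x. x \<in> shadow b \<Omega> \<Longrightarrow> marginal b p h x = marginal b p f0 x) \<Longrightarrow>
      z \<in> \<Omega> \<Longrightarrow> f0 z = f1 z"
proof -
  have dom: "open \<Omega>" "convex \<Omega>"
    using f0 by (auto simp: positive_concave_def concave_on_iff)
  obtain K where K: "\<forall>x\<in>\<Omega>. \<bar>x \<bullet> b\<bar> \<le> K"
    using bdd by (auto simp: bounded_iff)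
  note interval = slice_interval[OF dom b K]
  have bound: "\<exists>C. \<forall>x. f x \<le> C" if "positive_concave \<Omega> f" for f
    using that by (auto simp: positive_concave_def bdd_above_def)
  obtain C0 C1 C where C: "\<And>x. f0 x \<le> C0" "\<And>x. f1 x \<le> C1" "\<And>x. h x \<le> C"
    using bound[OF f0] bound[OF f1] bound[OF h] by auto
  have slice_le: "(1 - t) * f0 (x + r *\<^sub>R b) + t * f1 (y + s *\<^sub>R b)
        \<le> h (((1 - t) *\<^sub>R x + t *\<^sub>R y) + ((1 - t) * r + t * s) *\<^sub>R b)"
    and slice_mem: "((1 - t) *\<^sub>R x + t *\<^sub>R y) + ((1 - t) * r + t * s) *\<^sub>R b \<in> \<Omega>"
    if "x + r *\<^sub>R b \<in> \<Omega>" "y + s *\<^sub>R b \<in> \<Omega>" for x y r s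
  proof -
    have eq: "(1 - t) *\<^sub>R (x + r *\<^sub>R b) + t *\<^sub>R (y + s *\<^sub>R b)
        = ((1 - t) *\<^sub>R x + t *\<^sub>R y) + ((1 - t) * r + t * s) *\<^sub>R b"
      by (simp add: algebra_simps)
    show "(1 - t) * f0 (x + r *\<^sub>R b) + t * f1 (y + s *\<^sub>R b)
        \<le> h (((1 - t) *\<^sub>R x + t *\<^sub>R y) + ((1 - t) * r + t * s) *\<^sub>R b)"
      using le[OF that] unfolding eq .
    show "((1 - t) *\<^sub>R x + t *\<^sub>R y) + ((1 - t) * r + t * s) *\<^sub>R b \<in> \<Omega>"
      using convexD[OF dom(2) that, of "1 - t" t] t unfolding eq by simp
  qed
  show "(1 - t) * marginal b p f0 x + t * marginal b p f1 y \<le> marginal b p h ((1 - t) *\<^sub>R x + t *\<^sub>R y)"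
    if x: "x \<in> shadow b \<Omega>" and y: "y \<in> shadow b \<Omega>"
  proof -
    let ?z = "(1 - t) *\<^sub>R x + t *\<^sub>R y"
    have z: "?z \<in> shadow b \<Omega>"
      using x y t convex_shadow[OF dom(2)] by (intro convexD) auto
    obtain a0 b0 where i0: "a0 < b0" "{r. x + r *\<^sub>R b \<in> \<Omega>} = {a0<..<b0}"
      by (rule interval[OF x]) (rule that)
    obtain a1 b1 where i1: "a1 < b1" "{r. y + r *\<^sub>R b \<in> \<Omega>} = {a1<..<b1}"
      by (rule interval[OF y]) (rule that)
    obtain c d where ih: "c < d" "{r. ?z + r *\<^sub>R b \<in> \<Omega>} = {c<..<d}"
      by (rule interval[OF z]) (rule that)
    note s0 = slice_integral[OF f0 p i0(2,1) C(1)]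
    note s1 = slice_integral[OF f1 p i1(2,1) C(2)]
    note sh = slice_integral[OF h p ih(2,1) C(3)]
    have "((1 - t) * (\<integral>r. f0 (x + r *\<^sub>R b) powr p \<partial>lborel) powr (1 / (p + 1))
        + t * (\<integral>r. f1 (y + r *\<^sub>R b) powr p \<partial>lborel) powr (1 / (p + 1))) powr (p + 1)
        \<le> (\<integral>r. h (?z + r *\<^sub>R b) powr p \<partial>lborel)"
      unfolding s0(5)[symmetric] s1(5)[symmetric] sh(5)[symmetric]
    proof (rule interval_brunn_minkowski(1)[OF t p i0(1) s0(4,1,2) i1(1) s1(4,1,2) ih(1) sh(4,1,2)])
      fix r s assume "r \<in> {a0<..<b0}" "s \<in> {a1<..<b1}"
      then have rs: "x + r *\<^sub>R b \<in> \<Omega>" "y + s *\<^sub>R b \<in> \<Omega>"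
        unfolding i0(2)[symmetric] i1(2)[symmetric] by simp_all
      show "(1 - t) * r + t * s \<in> {c<..<d}"
        unfolding ih(2)[symmetric] using slice_mem[OF rs] by simp
      show "(1 - t) * f0 (x + r *\<^sub>R b) + t * f1 (y + s *\<^sub>R b) \<le> h (?z + ((1 - t) * r + t * s) *\<^sub>R b)"
        by (rule slice_le[OF rs])
    qed
    then have "((1 - t) * marginal b p f0 x + t * marginal b p f1 y) powr (p + 1)
        \<le> (\<integral>r. h (?z + r *\<^sub>R b) powr p \<partial>lborel)"
      by (simp add: marginal_def)
    then have "(((1 - t) * marginal b p f0 x + t * marginal b p f1 y) powr (p + 1)) powr (1 / (p + 1))
        \<le> marginal b p h ?z"
      unfolding marginal_def[of b p h] using p by (intro powr_mono2) auto
    then show ?thesis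
      using p t by (simp add: powr_powr marginal_def)
  qed
  show "f0 z = f1 z"
    if m01: "\<And>x. x \<in> shadow b \<Omega> \<Longrightarrow> marginal b p f0 x = marginal b p f1 x"
      and mh: "\<And>x. x \<in> shadow b \<Omega> \<Longrightarrow> marginal b p h x = marginal b p f0 x"
      and z: "z \<in> \<Omega>"
  proof -
    have zs: "z \<in> shadow b \<Omega>"
      using z subset_shadow by blast
    obtain a c where i: "a < c" "{r. z + r *\<^sub>R b \<in> \<Omega>} = {a<..<c}"
      by (rule interval[OF zs]) (rule that)
    note s0 = slice_integral[OF f0 p i(2,1) C(1)]
    note s1 = slice_integral[OF f1 p i(2,1) C(2)]
    note sh = slice_integral[OF h p i(2,1) C(3)]
    have inj: "A = B" if "A powr (1 / (p + 1)) = B powr (1 / (p + 1))" "0 < A" "0 < B" for A B :: real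
    proof -
      have "(A powr (1 / (p + 1))) powr (p + 1) = (B powr (1 / (p + 1))) powr (p + 1)"
        using that(1) by simp
      then show ?thesis
        using that(2,3) p by (simp add: powr_powr)
    qed
    have "(1 - t) *\<^sub>R z + t *\<^sub>R z = z"
      by (simp flip: scaleR_add_left)
    note slice_le' = slice_le[of z _ z, unfolded this] and slice_mem' = slice_mem[of z _ z, unfolded this]
    have mem: "z + r *\<^sub>R b \<in> \<Omega> \<longleftrightarrow> r \<in> {a<..<c}" for r
      unfolding i(2)[symmetric] by simp
    \<comment> \<open>\<open>z\<close> is the point with parameter 0 on its own line. All three
      slices live on \<open>{a<..<c}\<close>, which supplies the common end points of the equality
      case.\<close>
    have "0 \<in> {a<..<c}"
      unfolding i(2)[symmetric] using z by simp
    then have "f0 (z + 0 *\<^sub>R b) = f1 (z + 0 *\<^sub>R b)"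
    proof (rule interval_brunn_minkowski(2)[OF t p i(1) s0(4,1,2) i(1) s1(4,1,2) i(1) sh(4,1,2), rotated -1])
      show "integral {a..c} (\<lambda>x. f0 (z + x *\<^sub>R b) powr p) = integral {a..c} (\<lambda>x. f1 (z + x *\<^sub>R b) powr p)"
        unfolding s0(5) s1(5)
        by (rule inj[OF _ s0(7) s1(7)]) (use m01[OF zs] in \<open>simp add: marginal_def\<close>)
      show "integral {a..c} (\<lambda>x. h (z + x *\<^sub>R b) powr p) = integral {a..c} (\<lambda>x. f0 (z + x *\<^sub>R b) powr p)"
        unfolding s0(5) sh(5)
        by (rule inj[OF _ sh(7) s0(7)]) (use mh[OF zs] in \<open>simp add: marginal_def\<close>)
      show "(1 - t) * x + t * y \<in> {a<..<c}" if "x \<in> {a<..<c}" "y \<in> {a<..<c}" for x y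
        using slice_mem'[of x y] that by (simp only: mem)
      show "(1 - t) * f0 (z + x *\<^sub>R b) + t * f1 (z + y *\<^sub>R b) \<le> h (z + ((1 - t) * x + t * y) *\<^sub>R b)"
        if "x \<in> {a<..<c}" "y \<in> {a<..<c}" for x y
        using slice_le'[of x y] that by (simp only: mem)
    qed auto
    then show ?thesis by simp
  qed
qed

text \<open>Undoing one integration calls for equality of all three marginals, so the conclusion
  must return \<open>h\<close> as well in order to be iterated.\<close>

lemma marginal_brunn_minkowski_eq:
  assumes f0: "positive_concave \<Omega> f0" and f1: "positive_concave \<Omega> f1" and h: "positive_concave \<Omega> h"
    and b: "b \<in> Basis" and bdd: "bounded ((\<lambda>x. x \<bullet> b) ` \<Omega>)"
    and t: "0 < t" "t < 1" and p: "0 < p"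
    and le: "\<And>x y. x \<in> \<Omega> \<Longrightarrow> y \<in> \<Omega> \<Longrightarrow>
      (1 - t) * f0 x + t * f1 y \<le> h ((1 - t) *\<^sub>R x + t *\<^sub>R y)"
    and m01: "\<And>x. x \<in> shadow b \<Omega> \<Longrightarrow> marginal b p f0 x = marginal b p f1 x"
    and mh: "\<And>x. x \<in> shadow b \<Omega> \<Longrightarrow> marginal b p h x = marginal b p f0 x"
    and z: "z \<in> \<Omega>"
  shows "f0 z = f1 z" "h z = f0 z"
proof -
  have eq: "f0 z = f1 z" if z: "z \<in> \<Omega>" for z
    by (rule marginal_brunn_minkowski(2)[OF f0 f1 h b bdd t p]) (fact le m01 mh z)+
  show "f0 z = f1 z" by (rule eq[OF z])
  have "f0 x \<le> h x" if "x \<in> \<Omega>" for x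
    using le[OF that that] eq[OF that] by (simp add: algebra_simps flip: scaleR_add_left)
  moreover have "(1 - t) * h x + t * h y \<le> h ((1 - t) *\<^sub>R x + t *\<^sub>R y)" if "x \<in> \<Omega>" "y \<in> \<Omega>" for x y
    using h t that by (intro concave_onD) (auto simp: positive_concave_def)
  \<comment> \<open>so the equality case also applies with \<open>h\<close> in place of \<open>f1\<close>\<close>
  ultimately have "(1 - t) * f0 x + t * h y \<le> h ((1 - t) *\<^sub>R x + t *\<^sub>R y)" if "x \<in> \<Omega>" "y \<in> \<Omega>" for x y
    using that t by (smt (verit) mult_left_mono)
  then have "f0 z = h z"
    by (rule marginal_brunn_minkowski(2)[OF f0 h h b bdd t p _ _ _ z]) (use mh in auto)
  then show "h z = f0 z" ..
qed

text \<open>Concavity is the marginal inequality with all three functions equal to \<open>f\<close>;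
  the upper bound combines the bound of \<open>f\<close> with the uniform slice width.\<close>

lemma positive_concave_marginal:
  assumes f: "positive_concave \<Omega> f"
    and b: "b \<in> Basis" and bdd: "bounded ((\<lambda>x. x \<bullet> b) ` \<Omega>)" and p: "0 < p"
  shows "positive_concave (shadow b \<Omega>) (marginal b p f)"
    and "x \<in> shadow b \<Omega> \<Longrightarrow> integrable lborel (\<lambda>r. f (x + r *\<^sub>R b) powr p)"
proof -
  have dom: "open \<Omega>" "convex \<Omega>"
    using f by (auto simp: positive_concave_def concave_on_iff)
  obtain K where K: "\<forall>x\<in>\<Omega>. \<bar>x \<bullet> b\<bar> \<le> K"
    using bdd by (auto simp: bounded_iff)
  obtain C where C: "\<And>x. f x \<le> C"
    using f by (auto simp: positive_concave_def bdd_above_def)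
  have slice: "0 < (\<integral>r. f (x + r *\<^sub>R b) powr p \<partial>lborel)"
    "(\<integral>r. f (x + r *\<^sub>R b) powr p \<partial>lborel) \<le> C powr p * (2 * K)"
    "integrable lborel (\<lambda>r. f (x + r *\<^sub>R b) powr p)"
    if x: "x \<in> shadow b \<Omega>" for x
  proof -
    obtain a c where i: "a < c" "c - a \<le> 2 * K" "{r. x + r *\<^sub>R b \<in> \<Omega>} = {a<..<c}"
      using slice_interval[OF dom b K x] by blast
    note s = slice_integral[OF f p i(3,1) C]
    show "0 < (\<integral>r. f (x + r *\<^sub>R b) powr p \<partial>lborel)"
      "integrable lborel (\<lambda>r. f (x + r *\<^sub>R b) powr p)"
      by (fact s(7), fact s(3))
    have "C powr p * (c - a) \<le> C powr p * (2 * K)"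
      using i by (intro mult_left_mono) auto
    then show "(\<integral>r. f (x + r *\<^sub>R b) powr p \<partial>lborel) \<le> C powr p * (2 * K)"
      using s(6) by linarith
  qed
  show "integrable lborel (\<lambda>r. f (x + r *\<^sub>R b) powr p)" if "x \<in> shadow b \<Omega>"
    by (rule slice(3)[OF that])
  have zero: "marginal b p f x = 0" if "x \<notin> shadow b \<Omega>" for x
  proof -
    have "f (x + r *\<^sub>R b) = 0" for r
      using that f unfolding shadow_def positive_concave_def by blast
    then show ?thesis by (simp add: marginal_def)
  qed
  show "positive_concave (shadow b \<Omega>) (marginal b p f)"
    unfolding positive_concave_def
  proof (intro conjI ballI allI impI zero open_shadow dom)
    show "concave_on (shadow b \<Omega>) (marginal b p f)"
      unfolding concave_on_def
    proof (rule convex_onI)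
      show "convex (shadow b \<Omega>)" by (rule convex_shadow[OF dom(2)])
      fix t x y assume t: "0 < (t::real)" "t < 1" and xy: "x \<in> shadow b \<Omega>" "y \<in> shadow b \<Omega>"
      have "(1 - t) * f u + t * f v \<le> f ((1 - t) *\<^sub>R u + t *\<^sub>R v)" if "u \<in> \<Omega>" "v \<in> \<Omega>" for u v
        using f t that by (intro concave_onD) (auto simp: positive_concave_def)
      then have "(1 - t) * marginal b p f x + t * marginal b p f y
          \<le> marginal b p f ((1 - t) *\<^sub>R x + t *\<^sub>R y)"
        by (rule marginal_brunn_minkowski(1)[OF f f f b bdd t p _ xy])
      then show "- marginal b p f ((1 - t) *\<^sub>R x + t *\<^sub>R y)
          \<le> (1 - t) * - marginal b p f x + t * - marginal b p f y"
        by simp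
    qed
    show "0 < marginal b p f x" if "x \<in> shadow b \<Omega>" for x
      using slice(1)[OF that] by (simp add: marginal_def)
    show "bdd_above (range (marginal b p f))"
    proof (rule bdd_aboveI2)
      fix x
      show "marginal b p f x \<le> (C powr p * (2 * K)) powr (1 / (p + 1))"
      proof (cases "x \<in> shadow b \<Omega>")
        case True
        then show ?thesis
          unfolding marginal_def using slice(1,2)[OF True] p by (intro powr_mono2) auto
      qed (simp add: zero)
    qed
  qed
qed

section \<open>Iterated marginals\<close>

text \<open>The coordinates are integrated out one after the other inside a fixed space; the functions stay
  defined on the whole space and become constant in the directions already treated.\<close>

primrec iter_marginal :: "'a::euclidean_space list \<Rightarrow> real \<Rightarrow> ('a \<Rightarrow> real) \<Rightarrow> 'a \<Rightarrow> real" where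
  "iter_marginal [] p f = f"
| "iter_marginal (b # bs) p f = iter_marginal bs (p + 1) (marginal b p f)"

primrec iter_shadow :: "'a::real_vector list \<Rightarrow> 'a set \<Rightarrow> 'a set" where
  "iter_shadow [] \<Omega> = \<Omega>"
| "iter_shadow (b # bs) \<Omega> = iter_shadow bs (shadow b \<Omega>)"

lemma bounded_shadow_Basis:
  assumes "\<forall>c\<in>set (b # bs). bounded ((\<lambda>x. x \<bullet> c) ` \<Omega>)" "distinct (b # bs)" "set (b # bs) \<subseteq> Basis"
  shows "\<forall>c\<in>set bs. bounded ((\<lambda>x. x \<bullet> c) ` shadow b \<Omega>)"
proof
  fix c assume "c \<in> set bs"
  then show "bounded ((\<lambda>x. x \<bullet> c) ` shadow b \<Omega>)"
    using assms by (intro bounded_shadow) (auto simp: inner_Basis)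
qed

text \<open>The hypothesis of the Borell-Brascamp-Lieb inequality, bundled in a form that is stable
  under \<open>marginal\<close>.\<close>

definition interpolating :: "real \<Rightarrow> 'a::euclidean_space set \<Rightarrow> ('a \<Rightarrow> real) \<Rightarrow> ('a \<Rightarrow> real) \<Rightarrow> ('a \<Rightarrow> real) \<Rightarrow> bool" where
  "interpolating t \<Omega> f0 f1 h \<longleftrightarrow>
    positive_concave \<Omega> f0 \<and> positive_concave \<Omega> f1 \<and> positive_concave \<Omega> h \<and>
    (\<forall>x\<in>\<Omega>. \<forall>y\<in>\<Omega>. (1 - t) * f0 x + t * f1 y \<le> h ((1 - t) *\<^sub>R x + t *\<^sub>R y))"

lemma interpolating_marginal:
  assumes I: "interpolating t \<Omega> f0 f1 h"
    and b: "b \<in> Basis" and bdd: "bounded ((\<lambda>x. x \<bullet> b) ` \<Omega>)"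
    and t: "0 < t" "t < 1" and p: "0 < p"
  shows "interpolating t (shadow b \<Omega>) (marginal b p f0) (marginal b p f1) (marginal b p h)"
proof -
  have f: "positive_concave \<Omega> f0" "positive_concave \<Omega> f1" "positive_concave \<Omega> h"
    and le: "\<And>x y. x \<in> \<Omega> \<Longrightarrow> y \<in> \<Omega> \<Longrightarrow> (1 - t) * f0 x + t * f1 y \<le> h ((1 - t) *\<^sub>R x + t *\<^sub>R y)"
    using I by (auto simp: interpolating_def)
  have "(1 - t) * marginal b p f0 x + t * marginal b p f1 y \<le> marginal b p h ((1 - t) *\<^sub>R x + t *\<^sub>R y)"
    if "x \<in> shadow b \<Omega>" "y \<in> shadow b \<Omega>" for x y
    using marginal_brunn_minkowski(1)[OF f b bdd t p le that] .
  then show ?thesis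
    using f positive_concave_marginal(1)[OF _ b bdd p] by (simp add: interpolating_def)
qed

lemma iter_marginal_le:
  assumes "interpolating t \<Omega> f0 f1 h" "0 < t" "t < 1" "0 < p"
    and "distinct bs" "set bs \<subseteq> Basis" "\<forall>b\<in>set bs. bounded ((\<lambda>x. x \<bullet> b) ` \<Omega>)"
    and "x \<in> iter_shadow bs \<Omega>" "y \<in> iter_shadow bs \<Omega>"
  shows "(1 - t) * iter_marginal bs p f0 x + t * iter_marginal bs p f1 y
      \<le> iter_marginal bs p h ((1 - t) *\<^sub>R x + t *\<^sub>R y)"
  using assms
proof (induction bs arbitrary: \<Omega> f0 f1 h p)
  case Nil
  then show ?case by (simp add: interpolating_def)
next
  case (Cons b bs)
  show ?case
    unfolding iter_marginal.simps
    by (rule Cons.IH[where \<Omega> = "shadow b \<Omega>"])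
      (use Cons.prems bounded_shadow_Basis[OF Cons.prems(7,5,6)] in \<open>simp_all add: interpolating_marginal\<close>)
qed

text \<open>Equality travels backwards: the induction hypothesis makes the three first marginals
  agree on the shadow, and \<open>marginal_brunn_minkowski_eq\<close> undoes the first
  integration.\<close>

lemma iter_marginal_eq:
  assumes "interpolating t \<Omega> f0 f1 h" "0 < t" "t < 1" "0 < p"
    and "distinct bs" "set bs \<subseteq> Basis" "\<forall>b\<in>set bs. bounded ((\<lambda>x. x \<bullet> b) ` \<Omega>)"
    and "\<forall>x\<in>iter_shadow bs \<Omega>. iter_marginal bs p f0 x = iter_marginal bs p f1 x \<and>
      iter_marginal bs p h x = iter_marginal bs p f0 x"
  shows "\<forall>x\<in>\<Omega>. f0 x = f1 x \<and> h x = f0 x"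
  using assms
proof (induction bs arbitrary: \<Omega> f0 f1 h p)
  case Nil
  then show ?case by simp
next
  case (Cons b bs)
  have f: "positive_concave \<Omega> f0" "positive_concave \<Omega> f1" "positive_concave \<Omega> h"
    and le: "\<And>x y. x \<in> \<Omega> \<Longrightarrow> y \<in> \<Omega> \<Longrightarrow> (1 - t) * f0 x + t * f1 y \<le> h ((1 - t) *\<^sub>R x + t *\<^sub>R y)"
    using Cons.prems(1) by (auto simp: interpolating_def)
  have b: "b \<in> Basis" "bounded ((\<lambda>x. x \<bullet> b) ` \<Omega>)"
    using Cons.prems by auto
  have eq: "\<forall>x\<in>shadow b \<Omega>. marginal b p f0 x = marginal b p f1 x \<and> marginal b p h x = marginal b p f0 x"
    by (rule Cons.IH[where p = "p + 1"])
      (use Cons.prems bounded_shadow_Basis[OF Cons.prems(7,5,6)] in \<open>simp_all add: interpolating_marginal\<close>)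
  have m: "marginal b p f0 x = marginal b p f1 x" "marginal b p h x = marginal b p f0 x"
    if "x \<in> shadow b \<Omega>" for x
    using bspec[OF eq that] by auto
  show ?case
    using marginal_brunn_minkowski_eq[OF f b Cons.prems(2-4) le m] by blast
qed

lemma iter_shadow_memI:
  assumes "y \<in> \<Omega>" "\<And>c. c \<in> Basis - set bs \<Longrightarrow> y \<bullet> c = x \<bullet> c" "set bs \<subseteq> Basis"
  shows "x \<in> iter_shadow bs \<Omega>"
  using assms
proof (induction bs arbitrary: \<Omega> y)
  case Nil
  then have "y = x" by (auto intro: euclidean_eqI)
  then show ?case using Nil by simp
next
  case (Cons b bs)
  \<comment> \<open>\<open>z\<close> lies on the line through \<open>y\<close> in direction
    \<open>b\<close> and has the coordinate of \<open>x\<close> there.\<close>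
  define z where "z = y + (x \<bullet> b - y \<bullet> b) *\<^sub>R b"
  have "z + (y \<bullet> b - x \<bullet> b) *\<^sub>R b = y"
    by (simp add: z_def algebra_simps)
  then have "z \<in> shadow b \<Omega>"
    using Cons.prems(1) unfolding shadow_def by (metis (mono_tags, lifting) mem_Collect_eq)
  moreover have "z \<bullet> c = x \<bullet> c" if "c \<in> Basis - set bs" for c
    using Cons.prems(2)[of c] Cons.prems(3) that
    by (cases "c = b") (auto simp: z_def inner_add_left inner_Basis)
  ultimately show ?case
    using Cons.IH[of z "shadow b \<Omega>"] Cons.prems(3) by simp
qed

lemma iter_shadow_Basis:
  fixes \<Omega> :: "'a::euclidean_space set"
  assumes "\<Omega> \<noteq> {}" "set bs = Basis"
  shows "iter_shadow bs \<Omega> = UNIV"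
  using assms iter_shadow_memI[of _ \<Omega> bs] by fastforce

lemma iter_marginal_pos:
  assumes "positive_concave \<Omega> f" "0 < p"
    and "distinct bs" "set bs \<subseteq> Basis" "\<forall>b\<in>set bs. bounded ((\<lambda>x. x \<bullet> b) ` \<Omega>)"
    and "x \<in> iter_shadow bs \<Omega>"
  shows "0 < iter_marginal bs p f x"
  using assms
proof (induction bs arbitrary: \<Omega> f p)
  case Nil
  then show ?case by (simp add: positive_concave_def)
next
  case (Cons b bs)
  show ?case
    unfolding iter_marginal.simps
    by (rule Cons.IH[where \<Omega> = "shadow b \<Omega>"])
      (use Cons.prems bounded_shadow_Basis[OF Cons.prems(5,3,4)] in \<open>simp_all add: positive_concave_marginal(1)\<close>)
qed

section \<open>Iterated marginals as integrals over the whole space\<close>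

text \<open>Tonelli's theorem: each marginal raised to \<open>p + 1\<close> is the integral of
  \<open>f powr p\<close> along \<open>b\<close>, and that is exactly the power at which the next
  marginal starts, so the roots cancel. Nonnegative integrals spare a check of integrability at each
  stage.\<close>

lemma iter_marginal_powr:
  assumes "positive_concave \<Omega> f" "distinct bs" "set bs \<subseteq> Basis"
    and "\<forall>b\<in>set bs. bounded ((\<lambda>x. x \<bullet> b) ` \<Omega>)" "0 < p"
  shows "ennreal (iter_marginal bs p f x powr (p + length bs)) =
    (\<integral>\<^sup>+y. ennreal (f (x + (\<Sum>b\<in>set bs. y b *\<^sub>R b)) powr p) \<partial>Pi\<^sub>M (set bs) (\<lambda>_. lborel))"
  using assms
proof (induction bs arbitrary: \<Omega> f p)
  case Nil
  then show ?case
    by (simp only: list.set) (subst product_sigma_finite.nn_integral_empty; simp add: product_sigma_finite_def sigma_finite_lborel)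
next
  case (Cons b bs)
  interpret product_sigma_finite "\<lambda>_. lborel :: real measure" by standard
  have b: "b \<in> Basis" "bounded ((\<lambda>x. x \<bullet> b) ` \<Omega>)" and f: "positive_concave \<Omega> f" and p: "0 < p"
    using Cons.prems by auto
  note [measurable] = positive_concave_measurable[OF f]
  let ?y = "\<lambda>y. x + (\<Sum>b\<in>set bs. y b *\<^sub>R b)"
  have slice: "ennreal (marginal b p f u powr (p + 1)) = (\<integral>\<^sup>+r. ennreal (f (u + r *\<^sub>R b) powr p) \<partial>lborel)" for u
  proof -
    have "integrable lborel (\<lambda>r. f (u + r *\<^sub>R b) powr p)"
    proof (cases "u \<in> shadow b \<Omega>")
      case False
      then have "f (u + r *\<^sub>R b) = 0" for r
        using f unfolding shadow_def positive_concave_def by blast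
      then show ?thesis by simp
    qed (rule positive_concave_marginal(2)[OF f b p])
    then have "(\<integral>\<^sup>+r. ennreal (f (u + r *\<^sub>R b) powr p) \<partial>lborel) = ennreal (\<integral>r. f (u + r *\<^sub>R b) powr p \<partial>lborel)"
      by (intro nn_integral_eq_integral) auto
    then show ?thesis
      using p by (simp add: marginal_def powr_powr)
  qed
  have "ennreal (iter_marginal (b # bs) p f x powr (p + length (b # bs)))
      = ennreal (iter_marginal bs (p + 1) (marginal b p f) x powr ((p + 1) + length bs))"
    by (simp add: ac_simps)
  also have "\<dots> = (\<integral>\<^sup>+y. ennreal (marginal b p f (?y y) powr (p + 1)) \<partial>Pi\<^sub>M (set bs) (\<lambda>_. lborel))"
    using Cons.prems bounded_shadow_Basis[OF Cons.prems(4,2,3)]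
    by (intro Cons.IH[of "shadow b \<Omega>"] positive_concave_marginal(1)) auto
  also have "\<dots> = (\<integral>\<^sup>+y. (\<integral>\<^sup>+r. ennreal (f (?y y + r *\<^sub>R b) powr p) \<partial>lborel) \<partial>Pi\<^sub>M (set bs) (\<lambda>_. lborel))"
    by (simp add: slice)
  also have "\<dots> = (\<integral>\<^sup>+y. (\<integral>\<^sup>+r. ennreal (f (x + (\<Sum>c\<in>insert b (set bs). (y(b := r)) c *\<^sub>R c)) powr p) \<partial>lborel) \<partial>Pi\<^sub>M (set bs) (\<lambda>_. lborel))"
  proof (intro nn_integral_cong)
    fix y and r :: real
    have "(\<Sum>c\<in>set bs. (y(b := r)) c *\<^sub>R c) = (\<Sum>c\<in>set bs. y c *\<^sub>R c)"
      using Cons.prems(2) by (intro sum.cong) auto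
    then show "ennreal (f (?y y + r *\<^sub>R b) powr p)
        = ennreal (f (x + (\<Sum>c\<in>insert b (set bs). (y(b := r)) c *\<^sub>R c)) powr p)"
      using Cons.prems(2) by (simp add: ac_simps)
  qed
  also have "\<dots> = (\<integral>\<^sup>+y. ennreal (f (x + (\<Sum>c\<in>insert b (set bs). y c *\<^sub>R c)) powr p) \<partial>Pi\<^sub>M (insert b (set bs)) (\<lambda>_. lborel))"
    using Cons.prems(2) by (intro product_nn_integral_insert[symmetric]) auto
  finally show ?case by simp
qed

lemma iter_marginal_Basis:
  fixes f :: "'a::euclidean_space \<Rightarrow> real"
  assumes f: "positive_concave \<Omega> f" and bdd: "bounded \<Omega>" and p: "0 < p"
    and bs: "distinct bs" "set bs = Basis"
  shows "iter_marginal bs p f x = (\<integral>y. f y powr p \<partial>lborel) powr (1 / (p + DIM('a)))"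
    and "integrable lborel (\<lambda>y. f y powr p)"
proof -
  note [measurable] = positive_concave_measurable[OF f]
  have coord: "bounded ((\<lambda>x. x \<bullet> b) ` \<Omega>)" for b
    using bdd bounded_linear_image bounded_linear_inner_left by blast
  have len: "length bs = DIM('a)"
    using bs distinct_card by metis
  have "ennreal (iter_marginal bs p f x powr (p + DIM('a)))
      = (\<integral>\<^sup>+y. ennreal (f (x + (\<Sum>b\<in>Basis. y b *\<^sub>R b)) powr p) \<partial>Pi\<^sub>M Basis (\<lambda>_. lborel))"
    using iter_marginal_powr[OF f bs(1) _ _ p, of x] coord bs len by simp
  also have "\<dots> = (\<integral>\<^sup>+y. ennreal (f (x + y) powr p) \<partial>lborel)"
    by (subst (2) lborel_eq) (simp add: nn_integral_distr)
  also have "\<dots> = (\<integral>\<^sup>+y. ennreal (f y powr p) \<partial>distr lborel borel ((+) x))"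
    by (simp add: nn_integral_distr)
  also have "\<dots> = (\<integral>\<^sup>+y. ennreal (f y powr p) \<partial>lborel)"
    by (simp add: lborel_distr_plus)
  finally have eq: "(\<integral>\<^sup>+y. ennreal (f y powr p) \<partial>lborel) = ennreal (iter_marginal bs p f x powr (p + DIM('a)))" ..
  show int: "integrable lborel (\<lambda>y. f y powr p)"
    using eq by (intro integrableI_nonneg) auto
  have "(\<integral>y. f y powr p \<partial>lborel) = iter_marginal bs p f x powr (p + DIM('a))"
    using eq by (subst integral_eq_nn_integral) auto
  \<comment> \<open>Taking the root back requires a nonnegative base. The claim is made for every
    \<open>g\<close> because each step of the recursion replaces the function by its
    marginal.\<close>
  moreover have "0 \<le> iter_marginal bs q g x" if "\<And>y. 0 \<le> g y" for q and g :: "'a \<Rightarrow> real"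
    using that
  proof (induction bs arbitrary: q g)
    case (Cons b bs)
    show ?case by (simp, rule Cons.IH) (simp add: marginal_def)
  qed simp
  then have "0 \<le> iter_marginal bs p f x"
    using positive_concave_nonneg[OF f] by blast
  ultimately show "iter_marginal bs p f x = (\<integral>y. f y powr p \<partial>lborel) powr (1 / (p + DIM('a)))"
    using p by (simp add: powr_powr)
qed

text \<open>Once all coordinates are integrated out, the shadow is the whole space and the iterated
  marginals are the constants \<open>W f0\<close>, \<open>W f1\<close>, \<open>W h\<close>. The
  claims are then the iterated statements read at an arbitrary point.\<close>

theorem borell_brascamp_lieb_concave:
  fixes f0 f1 h :: "'a::euclidean_space \<Rightarrow> real" and t p :: real
  assumes I: "interpolating t \<Omega> f0 f1 h" and \<Omega>: "bounded \<Omega>" "\<Omega> \<noteq> {}"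
    and t: "0 < t" "t < 1" and p: "0 < p"
  defines "W \<equiv> \<lambda>f :: 'a \<Rightarrow> real. (\<integral>y. f y powr p \<partial>lborel) powr (1 / (p + DIM('a)))"
  shows "(1 - t) * W f0 + t * W f1 \<le> W h"
    and "W f0 = W f1 \<Longrightarrow> W h = W f0 \<Longrightarrow> \<forall>x\<in>\<Omega>. f0 x = f1 x"
    and "0 < W f0"
proof -
  obtain bs :: "'a list" where bs: "set bs = Basis" "distinct bs"
    using finite_distinct_list[OF finite_Basis] by blast
  have f: "positive_concave \<Omega> f0" "positive_concave \<Omega> f1" "positive_concave \<Omega> h"
    using I by (auto simp: interpolating_def)
  have W: "iter_marginal bs p g x = W g" if "positive_concave \<Omega> g" for g x
    unfolding W_def by (rule iter_marginal_Basis(1)[OF that \<Omega>(1) p bs(2,1)])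
  have coord: "\<forall>b\<in>set bs. bounded ((\<lambda>x. x \<bullet> b) ` \<Omega>)"
    using \<Omega>(1) bounded_linear_image bounded_linear_inner_left by blast
  note bs' = bs(2) equalityD1[OF bs(1)] coord
  have mem: "x \<in> iter_shadow bs \<Omega>" for x
    by (simp add: iter_shadow_Basis[OF \<Omega>(2) bs(1)])
  show "(1 - t) * W f0 + t * W f1 \<le> W h"
    using iter_marginal_le[OF I t p bs' mem mem] by (simp add: W f)
  show "\<forall>x\<in>\<Omega>. f0 x = f1 x" if "W f0 = W f1" "W h = W f0"
    using iter_marginal_eq[OF I t p bs'] that by (simp add: W f)
  show "0 < W f0"
    using iter_marginal_pos[OF f(1) p bs' mem] by (simp add: W f)
qed

section \<open>Legendre paths\<close>

text \<open>Fenchel-Moreau: the epigraph is closed and convex, and a hyperplane separating it from a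
  point just below the graph yields an affine minorant almost touching \<open>v\<close> at
  \<open>x\<close>.\<close>

lemma legendre_biconjugate:
  fixes \<Omega> :: "(real ^ 'n) set"
  assumes bdd: "bounded \<Omega>" and cont: "continuous_on (closure \<Omega>) v" and conv: "convex_on (closure \<Omega>) v"
    and x: "x \<in> closure \<Omega>"
  shows "legendre_on UNIV (legendre_on (closure \<Omega>) v) x = v x"
proof (rule antisym)
  let ?\<phi> = "legendre_on (closure \<Omega>) v"
  have young: "z \<bullet> y - v z \<le> ?\<phi> y" if "z \<in> closure \<Omega>" for z y
    unfolding legendre_on_def by (rule cSUP_upper[OF that legendre_on_closure_bdd[OF bdd cont]])
  have le: "y \<bullet> x - ?\<phi> y \<le> v x" for y
    using young[OF x, of y] by (simp add: inner_commute)
  show "legendre_on UNIV ?\<phi> x \<le> v x"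
    unfolding legendre_on_def[of UNIV] by (rule cSUP_least) (use le in auto)
  show "v x \<le> legendre_on UNIV ?\<phi> x"
  proof (rule field_le_epsilon)
    fix e :: real assume e: "0 < e"
    let ?E = "epigraph (closure \<Omega>) v"
    have "?E = (closure \<Omega> \<times> UNIV) \<inter> (\<lambda>z. v (fst z) - snd z) -` {..0}"
      by (auto simp: epigraph_def)
    moreover have "closed ((closure \<Omega> \<times> UNIV) \<inter> (\<lambda>z. v (fst z) - snd z) -` {..0})"
      by (intro continuous_closed_preimage continuous_intros continuous_on_compose2[OF cont]
          closed_Times) auto
    ultimately have "closed ?E"
      by simp
    then obtain a b where ab: "a \<bullet> (x, v x - e) < b" "\<forall>z\<in>?E. b < a \<bullet> z"
      using separating_hyperplane_closed_point[of ?E "(x, v x - e)"] convex_epigraphI[OF conv] e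
      by (auto simp: epigraph_def)
    obtain l s where a: "a = (l, s)" by (cases a)
    \<comment> \<open>Comparing the hyperplane at \<open>(x, v x)\<close> and at
      \<open>(x, v x - e)\<close> shows that it is not vertical.\<close>
    have "b < l \<bullet> x + s * v x"
      using bspec[OF ab(2), of "(x, v x)"] x by (simp add: a epigraph_def)
    then have "0 < s * e"
      using ab(1) by (simp add: a algebra_simps)
    then have s: "0 < s" using e by (simp add: zero_less_mult_iff)
    \<comment> \<open>The slope of the affine minorant: solving the hyperplane equation for the
      height gives \<open>z \<bullet> y + b / s < v z\<close> on the closure of \<Omega>.\<close>
    define y where "y = - (l /\<^sub>R s)"
    have "?\<phi> y \<le> - b / s"
      unfolding legendre_on_def
    proof (rule cSUP_least)
      show "closure \<Omega> \<noteq> {}" using x by auto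
      fix z assume "z \<in> closure \<Omega>"
      then have "b < l \<bullet> z + s * v z"
        using bspec[OF ab(2), of "(z, v z)"] by (simp add: a epigraph_def)
      then have "b / s < (l \<bullet> z + s * v z) / s"
        using s by (rule divide_strict_right_mono)
      moreover have "(l \<bullet> z + s * v z) / s = l \<bullet> z / s + v z"
        using s by (simp add: add_divide_distrib)
      moreover have "z \<bullet> y = - (l \<bullet> z / s)"
        by (simp add: y_def inner_commute divide_inverse_commute)
      ultimately show "z \<bullet> y - v z \<le> - b / s"
        by simp
    qed
    moreover have "v x - e < y \<bullet> x + b / s"
      using ab(1) s by (simp add: y_def a field_simps)
    moreover have "y \<bullet> x - ?\<phi> y \<le> legendre_on UNIV ?\<phi> x"
      unfolding legendre_on_def[of UNIV] by (rule cSUP_upper[OF UNIV_I bdd_aboveI2[OF le]])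
    ultimately show "v x \<le> legendre_on UNIV ?\<phi> x + e"
      by simp
  qed
qed

text \<open>A line through an interior point meets the frontier on both sides, which puts the point
  between two zeros and gives \<open>v \<le> 0\<close>. Some \<open>w\<close> has a negative value,
  and \<open>x\<close> is a convex combination, with positive weight on \<open>w\<close>, of
  \<open>w\<close> and a further point of \<Omega>.\<close>

lemma convex_zero_frontier_neg:
  fixes \<Omega> :: "'a::euclidean_space set"
  assumes op: "open \<Omega>" and bdd: "bounded \<Omega>" and conv: "convex_on (closure \<Omega>) v"
    and frontier: "\<forall>x\<in>frontier \<Omega>. v x = 0" and nz: "\<exists>x\<in>closure \<Omega>. v x \<noteq> 0"
    and x: "x \<in> \<Omega>"
  shows "v x < 0"
proof -
  have cv: "v (a *\<^sub>R x + c *\<^sub>R y) \<le> a * v x + c * v y"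
    if "x \<in> closure \<Omega>" "y \<in> closure \<Omega>" "0 \<le> a" "0 \<le> c" "a + c = 1" for x y a c
    using conv that by (simp add: convex_on_def)
  have le0: "v z \<le> 0" if z: "z \<in> \<Omega>" for z
  proof -
    obtain l :: 'a where l: "l \<noteq> 0"
      using nonempty_Basis nonzero_Basis by blast
    have zi: "z \<in> interior \<Omega>" using z op by (simp add: interior_open)
    obtain d where d: "0 < d" "z + d *\<^sub>R l \<in> frontier \<Omega>"
      by (rule ray_to_frontier[OF bdd zi l]) (rule that)
    obtain e where e: "0 < e" "z + e *\<^sub>R (- l) \<in> frontier \<Omega>"
      by (rule ray_to_frontier[OF bdd zi, of "- l"]) (use l in simp, rule that)
    have "v ((e / (d + e)) *\<^sub>R (z + d *\<^sub>R l) + (d / (d + e)) *\<^sub>R (z + e *\<^sub>R (- l)))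
        \<le> (e / (d + e)) * v (z + d *\<^sub>R l) + (d / (d + e)) * v (z + e *\<^sub>R (- l))"
      using d e by (intro cv) (auto simp: frontier_def simp flip: add_divide_distrib)
    moreover have "(e / (d + e)) *\<^sub>R (z + d *\<^sub>R l) + (d / (d + e)) *\<^sub>R (z + e *\<^sub>R (- l)) = z"
    proof -
      have "(e / (d + e)) *\<^sub>R (z + d *\<^sub>R l) + (d / (d + e)) *\<^sub>R (z + e *\<^sub>R (- l))
          = (e / (d + e) + d / (d + e)) *\<^sub>R z + (e / (d + e) * d - d / (d + e) * e) *\<^sub>R l"
        by (simp add: algebra_simps)
      moreover have "e / (d + e) + d / (d + e) = 1"
        using d e by (simp flip: add_divide_distrib)
      ultimately show ?thesis by simp
    qed
    ultimately show ?thesis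
      using frontier d e by simp
  qed
  obtain w where w: "w \<in> closure \<Omega>" "v w \<noteq> 0"
    using nz by blast
  have w\<Omega>: "w \<in> \<Omega>"
    using w frontier op by (auto simp: frontier_def interior_open)
  then have wneg: "v w < 0"
    using le0[OF w\<Omega>] w(2) by simp
  obtain e where e: "0 < e" "ball x e \<subseteq> \<Omega>"
    using op x unfolding open_contains_ball by blast
  \<comment> \<open>Small enough that moving from \<open>x\<close> away from \<open>w\<close> by
    \<open>k *\<^sub>R (x - w)\<close> stays in the ball; the summand 1 keeps the denominator
    positive when \<open>w = x\<close>.\<close>
  define k where "k = e / (2 * (1 + dist w x))"
  have k: "0 < k" using e by (auto simp: k_def intro!: divide_pos_pos add_pos_nonneg)
  have "k * dist w x < e"
  proof -
    have "k * dist w x \<le> k * (1 + dist w x)" using k by simp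
    also have "\<dots> = e / 2"
      using zero_le_dist[of w x] by (simp add: k_def field_simps add_nonneg_eq_0_iff)
    finally show ?thesis using e by simp
  qed
  then have "x + k *\<^sub>R (x - w) \<in> ball x e"
    using k by (simp add: dist_norm norm_minus_commute)
  then have y: "x + k *\<^sub>R (x - w) \<in> \<Omega>" using e by blast
  have "v ((k / (1 + k)) *\<^sub>R w + (1 / (1 + k)) *\<^sub>R (x + k *\<^sub>R (x - w)))
      \<le> (k / (1 + k)) * v w + (1 / (1 + k)) * v (x + k *\<^sub>R (x - w))"
    using k w\<Omega> y closure_subset[of \<Omega>] by (intro cv) (auto simp flip: add_divide_distrib)
  moreover have "(k / (1 + k)) *\<^sub>R w + (1 / (1 + k)) *\<^sub>R (x + k *\<^sub>R (x - w)) = x"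
  proof -
    have "(k / (1 + k)) *\<^sub>R w + (1 / (1 + k)) *\<^sub>R (x + k *\<^sub>R (x - w))
        = (k / (1 + k) - 1 / (1 + k) * k) *\<^sub>R w + (1 / (1 + k) + 1 / (1 + k) * k) *\<^sub>R x"
      by (simp add: algebra_simps)
    moreover have "1 / (1 + k) + 1 / (1 + k) * k = 1"
      using k by (simp flip: add_divide_distrib)
    ultimately show ?thesis by simp
  qed
  moreover have "(k / (1 + k)) * v w < 0"
    by (rule mult_pos_neg) (use k wneg in auto)
  moreover have "(1 / (1 + k)) * v (x + k *\<^sub>R (x - w)) \<le> 0"
    by (rule mult_nonneg_nonpos) (use k le0[OF y] in auto)
  ultimately show ?thesis by simp
qed

text \<open>The upper bound is Young's inequality for both conjugates and makes the path negative
  inside \<Omega>; the lower bound tests the supremum at the slope 0 and makes the path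
  bounded.\<close>

lemma legendre_path_bounds:
  fixes \<Omega> :: "(real ^ 'n) set"
  assumes bdd: "bounded \<Omega>" and cont: "continuous_on (closure \<Omega>) v0" "continuous_on (closure \<Omega>) v1"
    and t: "t \<in> {0..1}" and x: "x \<in> closure \<Omega>"
  shows "legendre_path \<Omega> v0 v1 t x \<le> (1 - t) * v0 x + t * v1 x"
    and "- legendre_sum \<Omega> v0 v1 t 0 \<le> legendre_path \<Omega> v0 v1 t x"
proof -
  have young: "x \<bullet> y - v x \<le> legendre_on (closure \<Omega>) v y" if "continuous_on (closure \<Omega>) v" for v y
    unfolding legendre_on_def by (rule cSUP_upper[OF x legendre_on_closure_bdd[OF bdd that]])
  show "legendre_path \<Omega> v0 v1 t x \<le> (1 - t) * v0 x + t * v1 x"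
    unfolding legendre_path_def legendre_on_def[of UNIV]
  proof (rule cSUP_least)
    fix y
    have "(1 - t) * (x \<bullet> y - v0 x) + t * (x \<bullet> y - v1 x) \<le> legendre_sum \<Omega> v0 v1 t y"
      unfolding legendre_sum_def using t young cont by (intro add_mono mult_left_mono) auto
    then show "y \<bullet> x - legendre_sum \<Omega> v0 v1 t y \<le> (1 - t) * v0 x + t * v1 x"
      by (simp add: algebra_simps inner_commute)
  qed simp
  have "0 \<bullet> x - legendre_sum \<Omega> v0 v1 t 0 \<le> legendre_path \<Omega> v0 v1 t x"
    unfolding legendre_path_def legendre_on_def[of UNIV]
    by (rule cSUP_upper[OF _ legendre_path_bdd[OF bdd cont t x]]) simp
  then show "- legendre_sum \<Omega> v0 v1 t 0 \<le> legendre_path \<Omega> v0 v1 t x"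
    by simp
qed

text \<open>Only the upper half of infimal convolution duality is needed, and it is immediate because
  \<^term>\<open>legendre_sum \<Omega> v0 v1 t y\<close> is affine in \<open>t\<close>.\<close>

lemma legendre_path_jointly_convex:
  fixes \<Omega> :: "(real ^ 'n) set"
  assumes bdd: "bounded \<Omega>" and cont: "continuous_on (closure \<Omega>) v0" "continuous_on (closure \<Omega>) v1"
    and s: "s \<in> {0..1}" and t: "t \<in> {0..1}" and l: "0 \<le> l" "l \<le> 1"
    and x: "x \<in> closure \<Omega>" and y: "y \<in> closure \<Omega>"
  shows "legendre_path \<Omega> v0 v1 ((1 - l) * s + l * t) ((1 - l) *\<^sub>R x + l *\<^sub>R y)
    \<le> (1 - l) * legendre_path \<Omega> v0 v1 s x + l * legendre_path \<Omega> v0 v1 t y"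
  unfolding legendre_path_def[of _ _ _ "(1 - l) * s + l * t"] legendre_on_def[of UNIV]
proof (rule cSUP_least)
  fix z
  have up: "z \<bullet> w - legendre_sum \<Omega> v0 v1 r z \<le> legendre_path \<Omega> v0 v1 r w"
    if "r \<in> {0..1}" "w \<in> closure \<Omega>" for r w
    unfolding legendre_path_def legendre_on_def[of UNIV]
    by (rule cSUP_upper[OF _ legendre_path_bdd[OF bdd cont that]]) simp
  have "z \<bullet> ((1 - l) *\<^sub>R x + l *\<^sub>R y) - legendre_sum \<Omega> v0 v1 ((1 - l) * s + l * t) z
      = (1 - l) * (z \<bullet> x - legendre_sum \<Omega> v0 v1 s z) + l * (z \<bullet> y - legendre_sum \<Omega> v0 v1 t z)"
    by (simp add: legendre_sum_def algebra_simps)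
  also have "\<dots> \<le> (1 - l) * legendre_path \<Omega> v0 v1 s x + l * legendre_path \<Omega> v0 v1 t y"
    using l up[OF s x] up[OF t y] by (intro add_mono mult_left_mono) auto
  finally show "z \<bullet> ((1 - l) *\<^sub>R x + l *\<^sub>R y) - legendre_sum \<Omega> v0 v1 ((1 - l) * s + l * t) z
      \<le> (1 - l) * legendre_path \<Omega> v0 v1 s x + l * legendre_path \<Omega> v0 v1 t y" .
qed simp

section \<open>Concavity of the power of the integral and the equality case\<close>

theorem proposition3p1:
  fixes \<Omega> :: "(real ^ 'n) set"
    and v0 v1 :: "real ^ 'n \<Rightarrow> real"
    and q :: real and m :: nat
  assumes "CARD('n) \<ge> 2"
    and "\<Omega> \<noteq> {}" and "open \<Omega>" and "convex \<Omega>" and "bounded \<Omega>"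
    and "continuous_on (closure \<Omega>) v0" and "continuous_on (closure \<Omega>) v1"
    and "convex_on (closure \<Omega>) v0" and "convex_on (closure \<Omega>) v1"
    and "\<exists>x\<in>closure \<Omega>. v0 x \<noteq> 0" and "\<exists>x\<in>closure \<Omega>. v1 x \<noteq> 0"
    and "\<forall>x\<in>frontier \<Omega>. v0 x = 0" and "\<forall>x\<in>frontier \<Omega>. v1 x = 0"
    and "q > 1" and "real m \<ge> q"
  shows "concave_on {0..1} (path_P \<Omega> v0 v1 q m) \<and>
    (path_P \<Omega> v0 v1 q m constant_on {0..1} \<longrightarrow> (\<forall>x\<in>closure \<Omega>. v0 x = v1 x))"
proof -
  note op = assms(3) and conv = assms(4) and bdd = assms(5) and cont = assms(6,7)
  have q: "0 < q" using assms(14) by simp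
  have sub: "x \<in> closure \<Omega>" if "x \<in> \<Omega>" for x
    using that closure_subset by blast
  note bounds = legendre_path_bounds[OF bdd cont]
  note joint = legendre_path_jointly_convex[OF bdd cont]
  \<comment> \<open>The sign makes the functions positive, and the extension by zero turns integrals
    over \<Omega> into integrals over the space.\<close>
  define u where "u t x = (if x \<in> \<Omega> then - legendre_path \<Omega> v0 v1 t x else 0)" for t x
  have u_pos: "0 < u t x" if t: "t \<in> {0..1}" and x: "x \<in> \<Omega>" for t x
  proof -
    have "v0 x < 0" "v1 x < 0"
      using convex_zero_frontier_neg[OF op bdd assms(8,12,10) x]
        convex_zero_frontier_neg[OF op bdd assms(9,13,11) x] by auto
    then have "(1 - t) * v0 x + t * v1 x < 0"
      using t convex_bound_lt[of "v0 x" 0 "v1 x" "1 - t" t] by simp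
    then show ?thesis
      using bounds(1)[OF t sub[OF x]] x by (simp add: u_def)
  qed
  have u_le: "(1 - l) * u s x + l * u t y \<le> u ((1 - l) * s + l * t) ((1 - l) *\<^sub>R x + l *\<^sub>R y)"
    if st: "s \<in> {0..1}" "t \<in> {0..1}" and l: "0 \<le> l" "l \<le> 1" and xy: "x \<in> \<Omega>" "y \<in> \<Omega>" for s t l x y
  proof -
    have "(1 - l) *\<^sub>R x + l *\<^sub>R y \<in> \<Omega>"
      using conv xy l by (intro convexD) auto
    then show ?thesis
      using joint[OF st l sub[OF xy(1)] sub[OF xy(2)]] xy by (simp add: u_def)
  qed
  have u_pc: "positive_concave \<Omega> (u t)" if t: "t \<in> {0..1}" for t
    unfolding positive_concave_def
  proof (intro conjI ballI allI impI)
    \<comment> \<open>Joint concavity \<open>u_le\<close> with both times equal to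
      \<open>t\<close>.\<close>
    show "concave_on \<Omega> (u t)"
      unfolding concave_on_def
    proof (rule convex_onI[OF _ conv])
      fix l x y assume "0 < (l::real)" "l < 1" "x \<in> \<Omega>" "y \<in> \<Omega>"
      then show "- u t ((1 - l) *\<^sub>R x + l *\<^sub>R y) \<le> (1 - l) * - u t x + l * - u t y"
        using u_le[OF t t, of l x y] by (simp flip: distrib_right)
    qed
    show "bdd_above (range (u t))"
    proof (rule bdd_aboveI2)
      show "u t x \<le> max 0 (legendre_sum \<Omega> v0 v1 t 0)" for x
        using bounds(2)[OF t sub, of x] by (auto simp: u_def)
    qed
  qed (auto simp: u_pos[OF t] op, simp add: u_def)
  define W where "W t = (\<integral>x. u t x powr q \<partial>lborel) powr (1 / (q + DIM(real ^ 'n)))" for t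
  have mix: "(1 - l) * s + l * t \<in> {0..1}" if "s \<in> {0..1}" "t \<in> {0..1}" "0 < l" "l < 1" for s t l :: real
    using that convexD_alt[of "{0..1::real}" s t l] by simp
  have interp: "interpolating l \<Omega> (u s) (u t) (u ((1 - l) * s + l * t))"
    if "s \<in> {0..1}" "t \<in> {0..1}" "0 < l" "l < 1" for s t l
    unfolding interpolating_def using that u_le mix by (auto simp: u_pc less_imp_le)
  note bbl = borell_brascamp_lieb_concave[OF interp bdd assms(2) _ _ q, folded W_def]
  have W_pos: "0 < W t" if "t \<in> {0..1}" for t
    by (rule bbl(3)[of t t "1 / 2"]) (use that in auto)
  \<comment> \<open>The ratio of the exponent \<open>1 / (n + m)\<close> of \<open>P\<close> to the
    exponent \<open>1 / (n + q)\<close> of \<open>W\<close>, with \<open>n = CARD('n)\<close>. It is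
    at most 1 because \<open>q \<le> m\<close>, so that \<open>x powr \<alpha>\<close> is concave
    and increasing.\<close>
  define \<alpha> where "\<alpha> = (q + CARD('n)) / real (CARD('n) + m)"
  have \<alpha>: "0 < \<alpha>" "\<alpha> \<le> 1"
    using q assms(15) by (auto simp: \<alpha>_def divide_simps)
  have S: "path_S \<Omega> v0 v1 q t = (\<integral>x. u t x powr q \<partial>lborel)" if t: "t \<in> {0..1}" for t
  proof -
    have [measurable]: "u t \<in> borel_measurable borel"
      by (rule positive_concave_measurable[OF u_pc[OF t]])
    have "indicat_real \<Omega> x *\<^sub>R \<bar>legendre_path \<Omega> v0 v1 t x\<bar> powr q = u t x powr q" for x
      using u_pos[OF t, of x] by (auto simp: u_def indicator_def)
    then have "path_S \<Omega> v0 v1 q t = (\<integral>x. u t x powr q \<partial>lebesgue)"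
      by (simp add: path_S_def set_lebesgue_integral_def)
    then show ?thesis
      by (simp add: integral_completion)
  qed
  have P: "path_P \<Omega> v0 v1 q m t = W t powr \<alpha>" if "t \<in> {0..1}" for t
    using q by (simp add: path_P_def S[OF that] W_def \<alpha>_def powr_powr)
  have "concave_on {0..1} (path_P \<Omega> v0 v1 q m)"
    unfolding concave_on_def
  proof (rule convex_onI)
    fix l s t :: real assume l: "0 < l" "l < 1" and st: "s \<in> {0..1}" "t \<in> {0..1}"
    have "(1 - l) * W s powr \<alpha> + l * W t powr \<alpha> \<le> ((1 - l) * W s + l * W t) powr \<alpha>"
      by (rule weighted_mean_powr_le[OF W_pos W_pos l \<alpha>]) (fact st)+
    also have "\<dots> \<le> W ((1 - l) * s + l * t) powr \<alpha>"
      using bbl(1)[OF st l l] W_pos[OF st(1)] W_pos[OF st(2)] l \<alpha> by (intro powr_mono2) auto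
    finally show "- path_P \<Omega> v0 v1 q m ((1 - l) *\<^sub>R s + l *\<^sub>R t)
        \<le> (1 - l) * - path_P \<Omega> v0 v1 q m s + l * - path_P \<Omega> v0 v1 q m t"
      using P mix[OF st l] st by simp
  qed simp
  moreover have "\<forall>x\<in>closure \<Omega>. v0 x = v1 x" if const: "path_P \<Omega> v0 v1 q m constant_on {0..1}"
  proof
    obtain c where c: "\<And>t. t \<in> {0..1} \<Longrightarrow> path_P \<Omega> v0 v1 q m t = c"
      using const by (auto simp: constant_on_def)
    have W_eq: "W s = W t" if "s \<in> {0..1}" "t \<in> {0..1}" for s t
    proof -
      have "(W s powr \<alpha>) powr (1 / \<alpha>) = (W t powr \<alpha>) powr (1 / \<alpha>)"
        using c P that by metis
      then show ?thesis
        using \<alpha> W_pos that by (simp add: powr_powr less_imp_le)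
    qed
    \<comment> \<open>The equality case with weight \<open>1 / 2\<close>, where \<open>W\<close> is
      compared at 0, 1 and the midpoint.\<close>
    have u_eq: "\<forall>x\<in>\<Omega>. u 0 x = u 1 x"
      by (rule bbl(2)[of 0 1 "1 / 2"]) (auto intro!: W_eq)
    fix x assume x: "x \<in> closure \<Omega>"
    show "v0 x = v1 x"
    proof (cases "x \<in> \<Omega>")
      case True
      \<comment> \<open>At the ends of the path the sum of conjugates reduces to a single conjugate,
        and biconjugation recovers the original function.\<close>
      have "legendre_path \<Omega> v0 v1 0 x = v0 x" "legendre_path \<Omega> v0 v1 1 x = v1 x"
        using legendre_biconjugate[OF bdd cont(1) assms(8) x] legendre_biconjugate[OF bdd cont(2) assms(9) x]
        by (simp_all add: legendre_path_def legendre_sum_def[abs_def])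
      then show ?thesis
        using bspec[OF u_eq True] True by (simp add: u_def)
    next
      case False
      then have "x \<in> frontier \<Omega>"
        using x op by (simp add: frontier_def interior_open)
      then show ?thesis using assms(12,13) by simp
    qed
  qed
  ultimately show ?thesis by blast
qed

end
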